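(* Let $\hat{\mathbf{w}}\in\mathbb{R}^D$. Then $\mathrm{Var}_{\mathbf{w}\sim\mathcal{P}_{\hat{\mathbf{w}}}^\perp}[f(\mathbf{w},\mathbf{x})]=0$ for every training point $\mathbf{x}\in\mathcal{X}$. For a test point $\mathbf{x}_t\notin\mathcal{X}$, if there exists a reparameterization $\mathbf{w}'\in\bar{\mathcal{R}}^f_{\mathcal{X}}(\hat{\mathbf{w}})$ such that $\mathbf{w}'\notin\bar{\mathcal{R}}^f_{\mathcal{X}\cup\{\mathbf{x}_t\}}(\hat{\mathbf{w}})$, then $\mathrm{Var}_{\mathbf{w}\sim\mathcal{P}_{\hat{\mathbf{w}}}^\perp}[f(\mathbf{w},\mathbf{x}_t)]>0$.
   Context: Setting. Let $f:\mathbb{R}^D\times\mathbb{R}^I\to\mathbb{R}^O$, $(\mathbf{w},\mathbf{x})\mapsto f(\mathbf{w},\mathbf{x})$, be a function (neural network) that is smooth in $\mathbf{w}$ for every $\mathbf{x}$, and let $\mathcal{X}=\{\mathbf{x}_1,\ldots,\mathbf{x}_N\}\subset\mathbb{R}^I$ be a finite training set. Standing assumption: the stacked Jacobian $\mathbf{J}_{\mathbf{w}}\in\mathbb{R}^{NO\times D}$ of $\mathbf{w}\mapsto(f(\mathbf{w},\mathbf{x}_1),\ldots,f(\mathbf{w},\mathbf{x}_N))$ has full rank $NO$ at every $\mathbf{w}\in\mathbb{R}^D$. Reparameterizations. For a set $S\subset\mathbb{R}^I$ let $\mathcal{R}^f_S(\mathbf{w})=\{\mathbf{w}'\in\mathbb{R}^D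 : f(\mathbf{w}',\mathbf{x})=f(\mathbf{w},\mathbf{x})\ \text{for all }\mathbf{x}\in S\}$, and let $\bar{\mathcal{R}}^f_S(\mathbf{w})$ be the set of all $\mathbf{w}'\in\mathbb{R}^D$ for which there exists a continuous, piecewise differentiable $\gamma:[0,1]\to\mathbb{R}^D$ with $\gamma(0)=\mathbf{w}$, $\gamma(1)=\mathbf{w}'$ and $\gamma(t)\in\mathcal{R}^f_S(\mathbf{w})$ for all $t\in[0,1]$. Kernel manifold and its distribution. $\mathcal{P}_{\hat{\mathbf{w}}}^\perp=\mathcal{R}^f_{\mathcal{X}}(\hat{\mathbf{w}})$ is an embedded smooth submanifold of $\mathbb{R}^D$, equipped with the Riemannian metric $\alpha\mathbf{I}$ ($\alpha>0$ fixed), i.e. $\alpha$ times the metric induced from the Euclidean metric. The notation $\mathbf{w}\sim\mathcal{P}_{\hat{\mathbf{w}}}^\perp$ means that $\mathbf{w}$ is distributed as the Riemannian diffusion (Brownian motion) on $(\mathcal{P}_{\hat{\mathbf{w}}}^\perp,\alpha\mathbf{I})$ started at $\hat{\mathbf{w}}$ and stopped at a fixed time $t>0$. Variance. For an $\mathbb{R}^O$-valued quantity, $\mathrm{Var}$ is the total variance $\mathbb{E}\|Z-\mathbb{E}Z\|^2$ (equivalently $\tfrac12\mathbb{E}\|Z-Z'\|^2\in[0,\infty]$ with $Z'$ an independent copy of $Z$, which makes sense without integrability assumptions). *)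

theory Defs
  imports "HOL-Probability.Probability"
begin

section \<open>Smooth maps\<close>

fun times_cont_diff ::
  "nat \<Rightarrow> ('a::euclidean_space \<Rightarrow> 'b::real_normed_vector) \<Rightarrow> bool" where
  "times_cont_diff 0 g \<longleftrightarrow> continuous_on UNIV g"
| "times_cont_diff (Suc n) g \<longleftrightarrow>
     (\<forall>w. g differentiable (at w)) \<and>
     (\<forall>v. times_cont_diff n (\<lambda>w. frechet_derivative g (at w) v))"

definition smooth_map :: "('a::euclidean_space \<Rightarrow> 'b::real_normed_vector) \<Rightarrow> bool" where
  "smooth_map g \<longleftrightarrow> (\<forall>n. times_cont_diff n g)"

text \<open>Test functions.  If a submanifold is a closed subset of the ambient space, the restrictions
  to it of these functions are exactly its compactly supported smooth functions.\<close>

definition test_function :: "('a::euclidean_space \<Rightarrow> real) \<Rightarrow> bool" where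
  "test_function \<phi> \<longleftrightarrow> smooth_map \<phi> \<and> compact (closure {w. \<phi> w \<noteq> 0})"


section \<open>Reparameterizations\<close>

definition reparam :: "('w \<Rightarrow> 'x \<Rightarrow> 'y) \<Rightarrow> 'x set \<Rightarrow> 'w \<Rightarrow> 'w set" where
  "reparam f S w = {w'. \<forall>x\<in>S. f w' x = f w x}"

definition path_reparam ::
  "('w::real_normed_vector \<Rightarrow> 'x \<Rightarrow> 'y) \<Rightarrow> 'x set \<Rightarrow> 'w \<Rightarrow> 'w set" where
  "path_reparam f S w =
     {w'. \<exists>\<gamma>::real \<Rightarrow> 'w. \<gamma> piecewise_differentiable_on {0..1} \<and>
            \<gamma> 0 = w \<and> \<gamma> 1 = w' \<and> (\<forall>t\<in>{0..1}. \<gamma> t \<in> reparam f S w)}"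


section \<open>The stacked network and its kernel manifolds\<close>

text \<open>The training points are listed by a finite index type; component \<open>(n, k)\<close> of the stacked
  map is the \<open>k\<close>-th output at the \<open>n\<close>-th training point.\<close>

definition stacked ::
  "('w \<Rightarrow> 'x \<Rightarrow> real^'o) \<Rightarrow> ('n::finite \<Rightarrow> 'x) \<Rightarrow> 'w \<Rightarrow> real^('n \<times> 'o)" where
  "stacked f xs w = (\<chi> p. f w (xs (fst p)) $ snd p)"

abbreviation stacked_jacobian ::
  "(real^'d \<Rightarrow> 'x \<Rightarrow> real^'o) \<Rightarrow> ('n::finite \<Rightarrow> 'x) \<Rightarrow> real^'d \<Rightarrow> real^'d^('n \<times> 'o)" where
  "stacked_jacobian f xs w \<equiv> jacobian (stacked f xs) (at w)"

text \<open>When the stacked Jacobian has full rank everywhere, the following is at every \<open>w\<close> the tangent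
  space at \<open>w\<close> of the level set \<open>reparam f (range xs) w\<close> through \<open>w\<close>; these level sets foliate the
  whole parameter space.\<close>

definition kernel_tangent ::
  "(real^'d \<Rightarrow> 'x \<Rightarrow> real^'o) \<Rightarrow> ('n::finite \<Rightarrow> 'x) \<Rightarrow> real^'d \<Rightarrow> (real^'d) set" where
  "kernel_tangent f xs w = {v. stacked_jacobian f xs w *v v = 0}"


section \<open>The Laplace--Beltrami operator of the metric \<open>\<alpha> I\<close>\<close>

text \<open>\<open>T\<close> assigns to each point the tangent space of the submanifold (leaf) through it, and the
  leaves carry \<open>\<alpha>\<close> times the metric induced from the Euclidean one.\<close>

definition scaled_metric :: "real \<Rightarrow> 'a::euclidean_space \<Rightarrow> 'a \<Rightarrow> real" where
  "scaled_metric \<alpha> u v = \<alpha> * (u \<bullet> v)"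

definition riem_grad ::
  "('a::euclidean_space \<Rightarrow> 'a set) \<Rightarrow> real \<Rightarrow> ('a \<Rightarrow> real) \<Rightarrow> 'a \<Rightarrow> 'a" where
  "riem_grad T \<alpha> \<phi> w =
     (THE v. v \<in> T w \<and> (\<forall>u\<in>T w. scaled_metric \<alpha> v u = frechet_derivative \<phi> (at w) u))"

definition orthonormal_frame :: "'a::euclidean_space set \<Rightarrow> real \<Rightarrow> 'a set \<Rightarrow> bool" where
  "orthonormal_frame U \<alpha> E \<longleftrightarrow>
     span E = U \<and>
     (\<forall>e\<in>E. \<forall>e'\<in>E. scaled_metric \<alpha> e e' = (if e = e' then 1 else 0))"

text \<open>The divergence of a tangent field \<open>V\<close> is the trace of \<open>v \<mapsto> \<nabla>\<^sub>v V\<close> on the tangent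
  space.  The Levi--Civita connection of a submanifold is the tangential part of the ambient
  derivative (scaling the metric by a constant does not change it); the projection is not written,
  because the derivative is only paired with tangent vectors.  Since \<open>e\<close> is tangent, only the values
  of \<open>V\<close> along the leaf through \<open>w\<close> contribute, and the trace does not depend on the frame.\<close>

definition riem_div ::
  "('a::euclidean_space \<Rightarrow> 'a set) \<Rightarrow> real \<Rightarrow> ('a \<Rightarrow> 'a) \<Rightarrow> 'a \<Rightarrow> real" where
  "riem_div T \<alpha> V w =
     (\<Sum>e\<in>(SOME E. orthonormal_frame (T w) \<alpha> E).
        scaled_metric \<alpha> (frechet_derivative V (at w) e) e)"

definition laplace_beltrami ::
  "('a::euclidean_space \<Rightarrow> 'a set) \<Rightarrow> real \<Rightarrow> ('a \<Rightarrow> real) \<Rightarrow> 'a \<Rightarrow> real" where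
  "laplace_beltrami T \<alpha> \<phi> = riem_div T \<alpha> (riem_grad T \<alpha> \<phi>)"


section \<open>Riemannian Brownian motion\<close>

definition martingale ::
  "'p measure \<Rightarrow> (real \<Rightarrow> 'p measure) \<Rightarrow> (real \<Rightarrow> 'p \<Rightarrow> real) \<Rightarrow> bool" where
  "martingale \<Omega> F N \<longleftrightarrow>
     (\<forall>s\<ge>0. N s \<in> borel_measurable (F s) \<and> integrable \<Omega> (N s)) \<and>
     (\<forall>s t. 0 \<le> s \<and> s \<le> t \<longrightarrow>
        (AE \<omega> in \<Omega>. real_cond_exp \<Omega> (F s) (N t) \<omega> = N s \<omega>))"

text \<open>Brownian motion on the closed submanifold \<open>M\<close> (with tangent spaces \<open>T\<close> and metric \<open>\<alpha> I\<close>)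
  started at \<open>w0\<close>: the diffusion generated by half the Laplace--Beltrami operator, that is, a
  solution of the corresponding martingale problem, with lifetime \<open>\<zeta>\<close>.  Stochastic completeness of
  \<open>M\<close> is not presupposed: if \<open>\<zeta>\<close> is finite, the path leaves every compact set as the time tends to
  \<open>\<zeta>\<close>.  Values \<open>X s \<omega>\<close> with \<open>s \<ge> \<zeta> \<omega>\<close> carry no meaning.\<close>

definition riemannian_brownian_motion ::
  "'a::euclidean_space set \<Rightarrow> ('a \<Rightarrow> 'a set) \<Rightarrow> real \<Rightarrow> 'a \<Rightarrow>
   'p measure \<Rightarrow> (real \<Rightarrow> 'p measure) \<Rightarrow> (real \<Rightarrow> 'p \<Rightarrow> 'a) \<Rightarrow> ('p \<Rightarrow> ereal) \<Rightarrow> bool" where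
  "riemannian_brownian_motion M T \<alpha> w0 \<Omega> F X \<zeta> \<longleftrightarrow>
     prob_space \<Omega> \<and>
     filtration (space \<Omega>) F \<and> (\<forall>s. subalgebra \<Omega> (F s)) \<and>
     (\<forall>s\<ge>0. X s \<in> borel_measurable (F s)) \<and>
     (\<forall>s\<ge>0. Measurable.pred (F s) (\<lambda>\<omega>. \<zeta> \<omega> \<le> ereal s)) \<and>
     (\<forall>\<omega>\<in>space \<Omega>.
        0 < \<zeta> \<omega> \<and> X 0 \<omega> = w0 \<and>
        (\<forall>s\<ge>0. ereal s < \<zeta> \<omega> \<longrightarrow> X s \<omega> \<in> M) \<and>
        continuous_on {s. 0 \<le> s \<and> ereal s < \<zeta> \<omega>} (\<lambda>s. X s \<omega>) \<and>
        (\<zeta> \<omega> < \<infinity> \<longrightarrow>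
           filterlim (\<lambda>s. X s \<omega>) at_infinity (at_left (real_of_ereal (\<zeta> \<omega>))))) \<and>
     (\<forall>\<phi>. test_function \<phi> \<longrightarrow>
        martingale \<Omega> F (\<lambda>s \<omega>.
          (if ereal s < \<zeta> \<omega> then \<phi> (X s \<omega>) else 0) - \<phi> (X 0 \<omega>) -
          (LINT r:{r. 0 \<le> r \<and> r \<le> s \<and> ereal r < \<zeta> \<omega>}|lborel.
             (1/2) * laplace_beltrami T \<alpha> \<phi> (X r \<omega>))))"

text \<open>The distribution on \<open>M\<close> of the process at time \<open>t\<close>.  If the lifetime is almost surely infinite
  this is just \<open>distr \<Omega> borel (X t)\<close>; otherwise it is conditioned on the process being alive.\<close>

definition law_at ::
  "'p measure \<Rightarrow> (real \<Rightarrow> 'p \<Rightarrow> 'a::euclidean_space) \<Rightarrow> ('p \<Rightarrow> ereal) \<Rightarrow> real \<Rightarrow> 'a measure" where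
  "law_at \<Omega> X \<zeta> t = distr (uniform_measure \<Omega> {\<omega>\<in>space \<Omega>. ereal t < \<zeta> \<omega>}) borel (X t)"


section \<open>Total variance\<close>

text \<open>Half the expected squared distance of two independent copies; this needs no integrability.\<close>

definition total_variance :: "'a measure \<Rightarrow> ('a \<Rightarrow> 'b::real_normed_vector) \<Rightarrow> ennreal" where
  "total_variance \<mu> Z =
     (\<integral>\<^sup>+ p. ennreal ((norm (Z (fst p) - Z (snd p)))\<^sup>2) \<partial>(\<mu> \<Otimes>\<^sub>M \<mu>)) / 2"

end

theory Submission
  imports Defs
begin

text \<open>On the leaf \<open>M\<close> every \<open>f(\<cdot>, x)\<close> with \<open>x\<close> a training point is constant, so its variance vanishes.

For the test point it suffices that the law \<open>\<mu>\<^sub>t\<close> charges every neighbourhood of every point of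
\<open>M\<close> that is joined to the start by a path in \<open>M\<close>: the function \<open>f(\<cdot>, x\<^sub>t)\<close> takes two different values
along such a path.  Taking expectations in the martingale problem gives
\<open>d/ds \<mu>\<^sub>s(\<phi>) = \<mu>\<^sub>s(\<Delta>\<phi> / 2)\<close> for test functions, and mass is spread by the parabolic barrier
\<open>u(s, x) = h(a(s) - |x - p|\<^sup>2)\<close> with \<open>h(r) = exp(-1/r)\<close> and \<open>a\<close> affine and decreasing.  Near the boundary
of its support \<open>h''\<close> dominates \<open>h'\<close> and \<open>|\<nabla>|x - p|\<^sup>2|\<close> is bounded below on \<open>M\<close>, hence
\<open>\<partial>\<^sub>s u + \<Delta>u / 2 + k u \<ge> 0\<close> on \<open>M\<close> for some \<open>k\<close>, so that \<open>exp(k s) \<mu>\<^sub>s(u(s, \<cdot>))\<close> is nondecreasing.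
Therefore mass in a ball around \<open>p\<close> at one time makes all smaller balls around \<open>p\<close> charged at all later
times.  The admissible radii are uniform on compact sets, and the set of charged points is open and
closed along the path.\<close>

section \<open>Calculus of smooth maps\<close>

text \<open>Derivatives are unique, so any explicit formula \<open>D\<close> may stand in for
  \<open>frechet_derivative\<close>. The closure rules below are proved by induction through this
  rule.\<close>

lemma times_cont_diff_SucI:
  assumes "\<And>w. (g has_derivative D w) (at w)" "\<And>v. times_cont_diff n (\<lambda>w. D w v)"
  shows "times_cont_diff (Suc n) g"
proof -
  have "frechet_derivative g (at w) = D w" for w
    using frechet_derivative_at[OF assms(1)] by metis
  moreover have "g differentiable (at w)" for w
    using assms(1) unfolding differentiable_def by blast
  ultimately show ?thesis using assms(2) by simp
qed

lemma times_cont_diff_SucD: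
  assumes "times_cont_diff (Suc n) g"
  shows "(g has_derivative frechet_derivative g (at w)) (at w)"
    "times_cont_diff n (\<lambda>w. frechet_derivative g (at w) v)"
  using assms by (auto simp: frechet_derivative_works[symmetric])

lemma times_cont_diff_continuous: "times_cont_diff n g \<Longrightarrow> continuous_on UNIV g"
  by (cases n) (auto intro!: differentiable_imp_continuous_on simp: differentiable_on_def)

lemma times_cont_diff_Suc: "times_cont_diff (Suc n) g \<Longrightarrow> times_cont_diff n g"
proof (induction n arbitrary: g)
  case 0
  then show ?case using times_cont_diff_continuous by (metis times_cont_diff.simps(1))
next
  case (Suc n)
  then show ?case by (metis times_cont_diff.simps(2))
qed

lemma times_cont_diff_const: "times_cont_diff n (\<lambda>w. c)"
  by (induction n arbitrary: c)
    (auto intro!: times_cont_diff_SucI[of _ "\<lambda>_ _. 0"] simp del: times_cont_diff.simps(2))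

lemma times_cont_diff_id: "times_cont_diff n (\<lambda>w. w)"
  by (cases n) (auto intro!: times_cont_diff_SucI[of _ "\<lambda>_ v. v"] times_cont_diff_const simp del: times_cont_diff.simps(2))

lemma times_cont_diff_bounded_linear:
  assumes "bounded_linear L"
  shows "times_cont_diff n g \<Longrightarrow> times_cont_diff n (\<lambda>w. L (g w))"
proof (induction n arbitrary: g)
  case 0
  then show ?case using bounded_linear.continuous_on[OF assms] by auto
next
  case (Suc n)
  show ?case
    by (rule times_cont_diff_SucI)
      (rule bounded_linear.has_derivative[OF assms] times_cont_diff_SucD[OF Suc.prems] Suc.IH)+
qed

lemma times_cont_diff_add:
  "times_cont_diff n f \<Longrightarrow> times_cont_diff n g \<Longrightarrow> times_cont_diff n (\<lambda>w. f w + g w)"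
proof (induction n arbitrary: f g)
  case 0
  then show ?case by (auto intro: continuous_on_add)
next
  case (Suc n)
  show ?case
    by (rule times_cont_diff_SucI)
      (rule has_derivative_add Suc.prems[THEN times_cont_diff_SucD(1)] 
        Suc.prems[THEN times_cont_diff_SucD(2)] Suc.IH)+
qed

text \<open>The product rule leaves two products, each with one factor differentiated once. The
  other factor is lowered to order \<open>n\<close> by \<open>times_cont_diff_Suc\<close>, so the
  induction must generalize over both factors.\<close>

lemma times_cont_diff_bounded_bilinear:
  assumes "bounded_bilinear pr"
  shows "times_cont_diff n f \<Longrightarrow> times_cont_diff n g \<Longrightarrow> times_cont_diff n (\<lambda>w. pr (f w) (g w))"
proof (induction n arbitrary: f g)
  case 0
  then show ?case using bounded_bilinear.continuous_on[OF assms] by auto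
next
  case (Suc n)
  show ?case
    by (rule times_cont_diff_SucI)
      (rule bounded_bilinear.FDERIV[OF assms] Suc.prems[THEN times_cont_diff_SucD(1)] 
        Suc.prems[THEN times_cont_diff_SucD(2)] Suc.IH times_cont_diff_add
        Suc.prems[THEN times_cont_diff_Suc])+
qed

text \<open>The derivative of \<open>1/f\<close> is built from \<open>f'\<close> and two factors
  \<open>1/f\<close>, so the induction hypothesis for the same \<open>f\<close> suffices.\<close>

lemma times_cont_diff_inverse:
  fixes f :: "'a::euclidean_space \<Rightarrow> real"
  assumes nz: "\<And>w. f w \<noteq> 0"
  shows "times_cont_diff n f \<Longrightarrow> times_cont_diff n (\<lambda>w. inverse (f w))"
proof (induction n)
  case 0
  then show ?case using nz by (auto intro: continuous_on_inverse)
next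
  case (Suc n)
  note IH = Suc.IH[OF times_cont_diff_Suc[OF Suc.prems]]
  show ?case
  proof (rule times_cont_diff_SucI)
    show "((\<lambda>w. inverse (f w)) has_derivative
        (\<lambda>v. - (inverse (f w) * frechet_derivative f (at w) v * inverse (f w)))) (at w)" for w
      using Deriv.has_derivative_inverse[OF nz times_cont_diff_SucD(1)[OF Suc.prems]] .
    show "times_cont_diff n (\<lambda>w. - (inverse (f w) * frechet_derivative f (at w) v * inverse (f w)))" for v
      by (intro times_cont_diff_bounded_linear[OF bounded_linear_minus[OF bounded_linear_ident]]
          times_cont_diff_bounded_bilinear[OF bounded_bilinear_mult] IH
          times_cont_diff_SucD(2)[OF Suc.prems])
  qed
qed

section \<open>Closure rules for smooth maps, collected for automation\<close>

named_theorems smooth_intros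

lemma smooth_map_const [smooth_intros]: "smooth_map (\<lambda>w. c)"
  by (simp add: smooth_map_def times_cont_diff_const)

lemma smooth_map_id [smooth_intros]: "smooth_map (\<lambda>w. w)"
  by (simp add: smooth_map_def times_cont_diff_id)

lemma smooth_map_bounded_linear:
  "bounded_linear L \<Longrightarrow> smooth_map g \<Longrightarrow> smooth_map (\<lambda>w. L (g w))"
  by (simp add: smooth_map_def times_cont_diff_bounded_linear)

lemmas smooth_map_vec_nth = smooth_map_bounded_linear[OF bounded_linear_vec_nth]
lemmas smooth_map_minus [smooth_intros] =
  smooth_map_bounded_linear[OF bounded_linear_minus[OF bounded_linear_ident]]

lemma smooth_map_add [smooth_intros]:
  "smooth_map f \<Longrightarrow> smooth_map g \<Longrightarrow> smooth_map (\<lambda>w. f w + g w)"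
  by (simp add: smooth_map_def times_cont_diff_add)

lemma smooth_map_diff [smooth_intros]:
  "smooth_map f \<Longrightarrow> smooth_map g \<Longrightarrow> smooth_map (\<lambda>w. f w - g w)"
  using smooth_map_add[OF _ smooth_map_minus, of f g] by simp

lemma smooth_map_bounded_bilinear:
  "bounded_bilinear pr \<Longrightarrow> smooth_map f \<Longrightarrow> smooth_map g \<Longrightarrow> smooth_map (\<lambda>w. pr (f w) (g w))"
  by (simp add: smooth_map_def times_cont_diff_bounded_bilinear)

lemmas smooth_map_mult [smooth_intros] =
    smooth_map_bounded_bilinear[OF bounded_bilinear_mult[where 'a=real]]
  and smooth_map_scaleR [smooth_intros] = smooth_map_bounded_bilinear[OF bounded_bilinear_scaleR]
  and smooth_map_inner [smooth_intros] = smooth_map_bounded_bilinear[OF bounded_bilinear_inner]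

lemma smooth_map_sum [smooth_intros]:
  "(\<And>i. i \<in> A \<Longrightarrow> smooth_map (\<lambda>w. f w i)) \<Longrightarrow> smooth_map (\<lambda>w. \<Sum>i\<in>A. f w i)"
  by (induction A rule: infinite_finite_induct) (auto intro!: smooth_intros)

lemma smooth_map_prod [smooth_intros]:
  fixes f :: "'a::euclidean_space \<Rightarrow> 'i \<Rightarrow> real"
  shows "(\<And>i. i \<in> A \<Longrightarrow> smooth_map (\<lambda>w. f w i)) \<Longrightarrow> smooth_map (\<lambda>w. \<Prod>i\<in>A. f w i)"
  by (induction A rule: infinite_finite_induct) (auto intro!: smooth_intros)

lemma smooth_map_divide [smooth_intros]:
  fixes f g :: "'a::euclidean_space \<Rightarrow> real"
  shows "smooth_map f \<Longrightarrow> smooth_map g \<Longrightarrow> (\<And>w. g w \<noteq> 0) \<Longrightarrow> smooth_map (\<lambda>w. f w / g w)"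
  unfolding divide_inverse
  by (intro smooth_intros) (auto simp: smooth_map_def intro: times_cont_diff_inverse)

lemma smooth_map_vec_lambda [smooth_intros]:
  fixes G :: "'a::euclidean_space \<Rightarrow> 'n::finite \<Rightarrow> real"
  assumes "\<And>i. smooth_map (\<lambda>w. G w i)"
  shows "smooth_map (\<lambda>w. \<chi> i. G w i)"
proof -
  have lin: "bounded_linear (\<lambda>x::real. \<chi> j. if j = i then x else 0)" for i :: 'n
    by (auto intro!: linearI simp: linear_conv_bounded_linear[symmetric] vec_eq_iff)
  have "(\<chi> i. G w i) = (\<Sum>i\<in>UNIV. \<chi> j. if j = i then G w i else 0)" for w
    by (simp add: vec_eq_iff)
  then show ?thesis
    by (simp only:) (intro smooth_map_sum smooth_map_bounded_linear[OF lin] assms)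
qed

lemma smooth_map_det [smooth_intros]:
  fixes A :: "'a::euclidean_space \<Rightarrow> real^'n^'n"
  assumes "\<And>i j. smooth_map (\<lambda>w. A w $ i $ j)"
  shows "smooth_map (\<lambda>w. det (A w))"
  unfolding det_def by (intro smooth_intros assms)

lemma smooth_map_differentiable: "smooth_map g \<Longrightarrow> g differentiable (at w)"
  unfolding smooth_map_def by (metis times_cont_diff.simps(2))

lemma smooth_map_has_derivative:
  "smooth_map g \<Longrightarrow> (g has_derivative frechet_derivative g (at w)) (at w)"
  using smooth_map_differentiable frechet_derivative_works by blast

lemma smooth_map_frechet_derivative [smooth_intros]:
  "smooth_map g \<Longrightarrow> smooth_map (\<lambda>w. frechet_derivative g (at w) v)"
  unfolding smooth_map_def by (metis times_cont_diff.simps(2))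

lemma smooth_map_continuous_on: "smooth_map g \<Longrightarrow> continuous_on S g"
  unfolding smooth_map_def using times_cont_diff_continuous continuous_on_subset by blast

section \<open>Tangential projections and the Laplace--Beltrami operator\<close>

text \<open>For a matrix of full row rank this is the Moore-Penrose inverse;
  \<open>kernel_proj\<close> is then the orthogonal projection onto the kernel. The explicit formula
  is what makes smooth dependence on the matrix provable.\<close>

definition right_inv :: "real^'n^'m \<Rightarrow> real^'m^'n" where
  "right_inv A = transpose A ** matrix_inv (A ** transpose A)"

definition kernel_proj :: "real^'n^'m \<Rightarrow> real^'n^'n" where
  "kernel_proj A = mat 1 - right_inv A ** A"

text \<open>Full row rank makes the transpose injective, and the quadratic form of the Gram matrix
  at \<open>y\<close> is the squared length of \<open>transpose A *v y\<close>.\<close>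

lemma det_gram_nonzero:
  fixes A :: "real^'n^'m"
  assumes "rank A = CARD('m)"
  shows "det (A ** transpose A) \<noteq> 0"
proof -
  have inj: "inj ((*v) (transpose A))"
    using assms by (simp add: full_rank_injective[symmetric] rank_transpose)
  have "y = 0" if "(A ** transpose A) *v y = 0" for y
  proof -
    have "(transpose A *v y) \<bullet> (transpose A *v y) = y \<bullet> (A *v (transpose A *v y))"
      by (metis dot_lmul_matrix transpose_matrix_vector)
    then have "transpose A *v y = 0"
      using that by (simp only: matrix_vector_mul_assoc inner_zero_right inner_eq_zero_iff)
    with inj show ?thesis by (metis injD matrix_vector_mult_0_right)
  qed
  then have "invertible (A ** transpose A)"
    by (metis invertible_left_inverse matrix_left_invertible_ker)
  then show ?thesis by (simp add: invertible_det_nz)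
qed

lemma right_inv:
  fixes A :: "real^'n^'m"
  assumes "rank A = CARD('m)"
  shows "A ** right_inv A = mat 1"
proof -
  have "invertible (A ** transpose A)"
    using det_gram_nonzero[OF assms] by (simp add: invertible_det_nz)
  then have "(A ** transpose A) ** matrix_inv (A ** transpose A) = mat 1"
    unfolding invertible_def matrix_inv_def by (metis (mono_tags, lifting) someI_ex)
  then show ?thesis
    by (simp add: right_inv_def matrix_mul_assoc)
qed

lemma kernel_proj_apply: "kernel_proj A *v v = v - right_inv A *v (A *v v)"
  by (simp add: kernel_proj_def matrix_vector_mult_diff_rdistrib matrix_vector_mul_assoc)

lemma kernel_proj_kernel:
  fixes A :: "real^'n^'m"
  assumes "rank A = CARD('m)"
  shows "A *v (kernel_proj A *v v) = 0"
  by (simp add: kernel_proj_apply matrix_vector_mult_diff_distrib matrix_vector_mul_assoc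
      matrix_mul_assoc right_inv[OF assms])

text \<open>The vector removed by the projection lies in the range of the transpose, which is
  orthogonal to the kernel.\<close>

lemma kernel_proj_inner:
  fixes A :: "real^'n^'m"
  assumes "A *v u = 0"
  shows "(kernel_proj A *v v) \<bullet> u = v \<bullet> u"
proof -
  have "(right_inv A *v (A *v v)) \<bullet> u = (transpose A *v (matrix_inv (A ** transpose A) *v (A *v v))) \<bullet> u"
    by (simp add: right_inv_def matrix_vector_mul_assoc matrix_mul_assoc)
  also have "\<dots> = (matrix_inv (A ** transpose A) *v (A *v v)) \<bullet> (A *v u)"
    by (metis dot_lmul_matrix transpose_matrix_vector)
  finally show ?thesis using assms by (simp add: kernel_proj_apply inner_diff_left)
qed

text \<open>Cramer's rule applied to the columns of the identity matrix. It exhibits the entries of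
  the inverse as quotients of determinants, from which their smoothness follows.\<close>

lemma matrix_inv_cramer:
  fixes A :: "real^'n^'n"
  assumes "det A \<noteq> 0"
  shows "matrix_inv A $ k $ l = det (\<chi> i j. if j = k then mat 1 $ i $ l else A $ i $ j) / det A"
proof -
  have "invertible A" using assms by (simp add: invertible_det_nz)
  then have inv: "A ** matrix_inv A = mat 1"
    unfolding invertible_def matrix_inv_def by (metis (mono_tags, lifting) someI_ex)
  have "A *v column l (matrix_inv A) = column l (mat 1)"
    unfolding inv[symmetric] by (simp add: vec_eq_iff column_def matrix_vector_mult_def matrix_matrix_mult_def)
  then have "column l (matrix_inv A) =
      (\<chi> k. det (\<chi> i j. if j = k then column l (mat 1) $ i else A $ i $ j) / det A)"
    using cramer[OF assms] by blast
  then show ?thesis by (simp add: vec_eq_iff column_def cong: if_cong)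
qed

lemma smooth_map_matrix_mult [smooth_intros]:
  fixes A :: "'a::euclidean_space \<Rightarrow> real^'n^'m" and B :: "'a \<Rightarrow> real^'k^'n"
  assumes "\<And>i j. smooth_map (\<lambda>w. A w $ i $ j)" "\<And>i j. smooth_map (\<lambda>w. B w $ i $ j)"
  shows "smooth_map (\<lambda>w. (A w ** B w) $ i $ j)"
  unfolding matrix_matrix_mult_def by (simp, intro smooth_intros assms)

lemma smooth_map_matrix_vector_mult [smooth_intros]:
  fixes A :: "'a::euclidean_space \<Rightarrow> real^'n^'m" and v :: "'a \<Rightarrow> real^'n"
  assumes "\<And>i j. smooth_map (\<lambda>w. A w $ i $ j)" "smooth_map v"
  shows "smooth_map (\<lambda>w. A w *v v w)"
  unfolding matrix_vector_mult_def by (intro smooth_intros assms smooth_map_vec_nth)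

lemma smooth_map_right_inv [smooth_intros]:
  fixes A :: "'a::euclidean_space \<Rightarrow> real^'n^'m"
  assumes A: "\<And>i j. smooth_map (\<lambda>w. A w $ i $ j)" and rank: "\<And>w. rank (A w) = CARD('m)"
  shows "smooth_map (\<lambda>w. right_inv (A w) $ i $ j)"
proof -
  have trA: "smooth_map (\<lambda>w. transpose (A w) $ i $ j)" for i j
    by (simp add: transpose_def A)
  have "smooth_map (\<lambda>w. matrix_inv (A w ** transpose (A w)) $ k $ l)" for k l
    unfolding matrix_inv_cramer[OF det_gram_nonzero[OF rank]]
  proof (intro smooth_map_divide smooth_map_det)
    show "smooth_map (\<lambda>w. (\<chi> i j. if j = k then mat 1 $ i $ l
                   else (A w ** transpose (A w)) $ i $ j) $ i $ j)" for i j
      using smooth_map_matrix_mult[OF A trA, of i j] by (cases "j = k") (auto intro: smooth_map_const)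
  qed (intro smooth_map_matrix_mult A trA det_gram_nonzero rank)+
  with trA show ?thesis unfolding right_inv_def by (intro smooth_intros)
qed

lemma smooth_map_kernel_proj [smooth_intros]:
  fixes A :: "'a::euclidean_space \<Rightarrow> real^'n^'m"
  assumes "\<And>i j. smooth_map (\<lambda>w. A w $ i $ j)" "\<And>w. rank (A w) = CARD('m)"
  shows "smooth_map (\<lambda>w. kernel_proj (A w) $ i $ j)"
  unfolding kernel_proj_def by (simp, intro smooth_intros assms)

section \<open>Frames, divergence and gradient on a single tangent space\<close>

lemma orthonormal_frame_exists:
  assumes "subspace U" "\<alpha> > 0"
  shows "\<exists>E. orthonormal_frame U \<alpha> E"
proof -
  obtain B where B: "B \<subseteq> U" "pairwise orthogonal B" "\<And>x. x \<in> B \<Longrightarrow> norm x = 1"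
    "independent B" "span B = U"
    using orthonormal_basis_subspace[OF assms(1)] by metis
  \<comment> \<open>Rescaling turns a Euclidean orthonormal basis into one for the metric scaled by
    \<alpha>.\<close>
  let ?s = "inverse (sqrt \<alpha>)"
  have "span ((*\<^sub>R) ?s ` B) = U"
    using span_image_scale[OF independent_imp_finite[OF B(4)], of "\<lambda>_. ?s"] B(5) assms(2) by simp
  moreover have "scaled_metric \<alpha> (?s *\<^sub>R b) (?s *\<^sub>R c) = (if ?s *\<^sub>R b = ?s *\<^sub>R c then 1 else 0)"
    if "b \<in> B" "c \<in> B" for b c
  proof (cases "b = c")
    case True
    then show ?thesis using B(3)[OF that(1)] assms(2)
      by (simp add: scaled_metric_def dot_square_norm field_simps flip: power2_eq_square)
  next
    case False
    then have "b \<bullet> c = 0" using B(2) that by (auto simp: pairwise_def orthogonal_def)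
    with False assms(2) show ?thesis by (simp add: scaled_metric_def)
  qed
  ultimately show ?thesis unfolding orthonormal_frame_def by blast
qed

lemma orthonormal_frame_expand:
  fixes E :: "'a::euclidean_space set"
  assumes E: "orthonormal_frame U \<alpha> E" and "\<alpha> > 0" "v \<in> U"
  shows "v = (\<Sum>e\<in>E. (\<alpha> * (v \<bullet> e)) *\<^sub>R e)" "finite E"
proof -
  have ip: "\<alpha> * (e \<bullet> e') = (if e = e' then 1 else 0)" if "e \<in> E" "e' \<in> E" for e e'
    using E that by (auto simp: orthonormal_frame_def scaled_metric_def)
  have "pairwise orthogonal E"
    unfolding pairwise_def orthogonal_def using ip \<open>\<alpha> > 0\<close> by (metis mult_eq_0_iff less_irrefl)
  moreover have "0 \<notin> E" using ip[of 0 0] by auto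
  ultimately show fin: "finite E"
    using pairwise_orthogonal_imp_finite by blast
  have "v \<in> span E" using assms by (auto simp: orthonormal_frame_def)
  then show "v = (\<Sum>e\<in>E. (\<alpha> * (v \<bullet> e)) *\<^sub>R e)"
  proof (rule sym[OF vector_eq_dot_span[rotated]])
    show "(\<Sum>e\<in>E. (\<alpha> * (v \<bullet> e)) *\<^sub>R e) \<in> span E"
      by (intro span_sum span_scale span_base)
    fix i assume "i \<in> E"
    have "i \<bullet> (\<Sum>e\<in>E. (\<alpha> * (v \<bullet> e)) *\<^sub>R e) = (\<Sum>e\<in>E. (v \<bullet> e) * (\<alpha> * (i \<bullet> e)))"
      by (simp add: inner_sum_right mult_ac)
    also have "\<dots> = (\<Sum>e\<in>E. if e = i then v \<bullet> i else 0)"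
      using \<open>i \<in> E\<close> by (intro sum.cong) (auto simp: ip)
    finally show "i \<bullet> (\<Sum>e\<in>E. (\<alpha> * (v \<bullet> e)) *\<^sub>R e) = i \<bullet> v"
      using fin \<open>i \<in> E\<close> by (simp add: inner_commute)
  qed
qed

text \<open>Unlike the sum over a chosen frame, the right-hand side visibly depends continuously on \<open>w\<close>.\<close>

lemma riem_div_eq_trace:
  fixes A :: "'a::euclidean_space \<Rightarrow> 'a" and T :: "'a \<Rightarrow> 'a set"
  assumes "subspace (T w)" "\<alpha> > 0"
    and A: "\<And>v. A v \<in> T w" "\<And>v u. u \<in> T w \<Longrightarrow> A v \<bullet> u = v \<bullet> u"
    and "V differentiable (at w)"
  shows "riem_div T \<alpha> V w = (\<Sum>b\<in>Basis. frechet_derivative V (at w) (A b) \<bullet> b)"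
proof -
  define E where "E = (SOME E. orthonormal_frame (T w) \<alpha> E)"
  define D where "D = frechet_derivative V (at w)"
  have E: "orthonormal_frame (T w) \<alpha> E"
    unfolding E_def using orthonormal_frame_exists[OF assms(1,2)] by (rule someI_ex)
  have D: "linear D"
    unfolding D_def by (simp add: assms(5) linear_frechet_derivative)
  have ET: "e \<in> T w" if "e \<in> E" for e
    using E that by (auto simp: orthonormal_frame_def span_base)
  \<comment> \<open>Expand the projected basis vector in the frame; its coefficients are those of
    \<open>b\<close> itself, since the frame is tangent. Summing over \<open>b\<close> then
    recombines to the trace over the frame.\<close>
  have "D (A b) \<bullet> b = (\<Sum>e\<in>E. \<alpha> * (e \<bullet> b) * (D e \<bullet> b))" for b
  proof -
    have "A b = (\<Sum>e\<in>E. (\<alpha> * (A b \<bullet> e)) *\<^sub>R e)"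
      by (rule orthonormal_frame_expand(1)[OF E assms(2) A(1)])
    also have "\<dots> = (\<Sum>e\<in>E. (\<alpha> * (e \<bullet> b)) *\<^sub>R e)"
      by (intro sum.cong refl) (metis A(2) ET inner_commute)
    finally show ?thesis
      by (simp add: linear_sum[OF D] linear_scale[OF D] inner_sum_left)
  qed
  then have "(\<Sum>b\<in>Basis. D (A b) \<bullet> b) = (\<Sum>e\<in>E. \<alpha> * (\<Sum>b\<in>Basis. (e \<bullet> b) * (D e \<bullet> b)))"
    by (simp add: sum.swap[of _ _ E] sum_distrib_left mult_ac)
  also have "\<dots> = (\<Sum>e\<in>E. \<alpha> * (D e \<bullet> e))"
    by (intro sum.cong refl) (metis euclidean_inner inner_commute)
  finally show ?thesis
    by (simp add: riem_div_def E_def D_def scaled_metric_def)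
qed

text \<open>Two vectors representing the differential differ by a tangent vector orthogonal to
  itself, so the definite description in \<open>riem_grad\<close> has exactly one candidate.\<close>

lemma riem_grad_eqI:
  assumes "subspace (T w)" "\<alpha> > 0" "v \<in> T w"
    and "\<And>u. u \<in> T w \<Longrightarrow> \<alpha> * (v \<bullet> u) = frechet_derivative \<phi> (at w) u"
  shows "riem_grad T \<alpha> \<phi> w = v"
  unfolding riem_grad_def scaled_metric_def
proof (rule the_equality)
  fix v' assume v': "v' \<in> T w \<and> (\<forall>u\<in>T w. \<alpha> * (v' \<bullet> u) = frechet_derivative \<phi> (at w) u)"
  then have d: "v' - v \<in> T w" using assms(1,3) by (auto intro: subspace_diff)
  then have "\<alpha> * (v' \<bullet> (v' - v)) = \<alpha> * (v \<bullet> (v' - v))" using v' assms(4) by metis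
  then have "(v' - v) \<bullet> (v' - v) = 0" using assms(2) by (simp add: inner_diff_left)
  then show "v' = v" by simp
qed (use assms in auto)

text \<open>The gradient of \<open>- |w - p|\<^sup>2\<close> along the leaves, its divergence, and its squared length.\<close>

definition radial_field :: "(real^'d \<Rightarrow> real^'d^'m) \<Rightarrow> real \<Rightarrow> real^'d \<Rightarrow> real^'d \<Rightarrow> real^'d" where
  "radial_field J \<alpha> p w = - (2 / \<alpha>) *\<^sub>R (kernel_proj (J w) *v (w - p))"

definition radial_div :: "(real^'d \<Rightarrow> real^'d^'m) \<Rightarrow> real \<Rightarrow> real^'d \<Rightarrow> real^'d \<Rightarrow> real" where
  "radial_div J \<alpha> p w =
     (\<Sum>b\<in>Basis. frechet_derivative (radial_field J \<alpha> p) (at w) (kernel_proj (J w) *v b) \<bullet> b)"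

definition radial_energy :: "(real^'d \<Rightarrow> real^'d^'m) \<Rightarrow> real \<Rightarrow> real^'d \<Rightarrow> real^'d \<Rightarrow> real" where
  "radial_energy J \<alpha> p w = \<alpha> * (radial_field J \<alpha> p w \<bullet> radial_field J \<alpha> p w)"

section \<open>Radial functions on the leaves of a full-rank field of matrices\<close>

locale full_rank_field =
  fixes J :: "real^'d \<Rightarrow> real^'d^'m" and \<alpha> :: real
  assumes smooth_J [smooth_intros]: "\<And>i j. smooth_map (\<lambda>w. J w $ i $ j)"
    and rank_J: "\<And>w. rank (J w) = CARD('m)"
    and \<alpha>_pos: "\<alpha> > 0"
begin

abbreviation T :: "real^'d \<Rightarrow> (real^'d) set" where
  "T w \<equiv> {v. J w *v v = 0}"

lemma subspace_T: "subspace (T w)"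
  by (auto simp: subspace_def matrix_vector_right_distrib matrix_vector_mult_scaleR)

lemma smooth_radial_field [smooth_intros]: "smooth_map (radial_field J \<alpha> p)"
  unfolding radial_field_def by (intro smooth_intros rank_J)

lemma radial_field_T: "radial_field J \<alpha> p w \<in> T w"
  by (simp add: radial_field_def kernel_proj_kernel[OF rank_J] matrix_vector_mult_scaleR
    del: scaleR_minus_left)

lemma radial_field_inner: "u \<in> T w \<Longrightarrow> \<alpha> * (radial_field J \<alpha> p w \<bullet> u) = - 2 * ((w - p) \<bullet> u)"
  using \<alpha>_pos by (simp add: radial_field_def kernel_proj_inner)

lemma continuous_radial_div: "continuous_on UNIV (radial_div J \<alpha> p)"
proof -
  \<comment> \<open>Smoothness of the derivative is available only in a fixed direction, whereas
    \<open>radial_div\<close> uses directions that vary with \<open>w\<close>. Expanding the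
    direction in the standard basis separates the two dependences.\<close>
  have "frechet_derivative (radial_field J \<alpha> p) (at w) v =
      (\<Sum>c\<in>Basis. (v \<bullet> c) *\<^sub>R frechet_derivative (radial_field J \<alpha> p) (at w) c)" for v w
  proof -
    let ?D = "frechet_derivative (radial_field J \<alpha> p) (at w)"
    have "linear ?D"
      by (rule linear_frechet_derivative[OF smooth_map_differentiable[OF smooth_radial_field]])
    moreover have "?D v = ?D (\<Sum>c\<in>Basis. (v \<bullet> c) *\<^sub>R c)"
      by (simp only: euclidean_representation)
    ultimately show ?thesis by (simp only: linear_sum linear_scale)
  qed
  then have "radial_div J \<alpha> p = (\<lambda>w. \<Sum>b\<in>Basis. (\<Sum>c\<in>Basis. ((kernel_proj (J w) *v b) \<bullet> c) *\<^sub>R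
      frechet_derivative (radial_field J \<alpha> p) (at w) c) \<bullet> b)"
    unfolding radial_div_def by (intro ext sum.cong refl arg_cong2[where f=inner])
  then show ?thesis
    by (simp only:) (intro smooth_map_continuous_on smooth_intros rank_J)
qed

lemma continuous_radial_energy: "continuous_on UNIV (radial_energy J \<alpha> p)"
  unfolding radial_energy_def by (intro smooth_map_continuous_on smooth_intros)

lemma radial_energy_nonneg: "radial_energy J \<alpha> p w \<ge> 0"
  using \<alpha>_pos by (simp add: radial_energy_def)

text \<open>The chain rule for the Laplacian: the gradient of \<open>q \<circ> \<rho>\<close> is
  \<open>q1(\<rho>)\<close> times that of \<open>\<rho>\<close>, and its divergence splits by the
  product rule. Here \<open>radial_div\<close> is the Laplacian of \<open>\<rho>\<close> and
  \<open>radial_energy\<close> the squared length of its gradient in the scaled metric.\<close>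

lemma laplace_beltrami_radial:
  fixes q q1 q2 :: "real \<Rightarrow> real" and p :: "real^'d" and a :: real
  defines "\<rho> w \<equiv> a - (w - p) \<bullet> (w - p)"
  assumes q: "\<And>r. (q has_real_derivative q1 r) (at r)"
    and q1: "\<And>r. (q1 has_real_derivative q2 r) (at r)"
  shows "laplace_beltrami T \<alpha> (\<lambda>w. q (\<rho> w)) w =
    q1 (\<rho> w) * radial_div J \<alpha> p w + q2 (\<rho> w) * radial_energy J \<alpha> p w"
proof -
  let ?V = "radial_field J \<alpha> p" and ?P = "\<lambda>w v. kernel_proj (J w) *v v"
  define D where "D w = frechet_derivative ?V (at w)" for w
  have \<rho>: "(\<rho> has_derivative (\<lambda>u. - 2 * ((w - p) \<bullet> u))) (at w)" for w
    unfolding \<rho>_def by (auto intro!: derivative_eq_intros simp: inner_commute)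
  have der: "((\<lambda>w. r (\<rho> w)) has_derivative (\<lambda>u. r' (\<rho> w) * (- 2 * ((w - p) \<bullet> u)))) (at w)"
    if "\<And>x. (r has_real_derivative r' x) (at x)" for r r' w
    using has_derivative_compose[OF \<rho> has_field_derivative_imp_has_derivative[OF that]]
    by (simp add: mult_ac)
  have grad: "riem_grad T \<alpha> (\<lambda>w. q (\<rho> w)) = (\<lambda>w. q1 (\<rho> w) *\<^sub>R ?V w)"
  proof (rule ext, rule riem_grad_eqI[OF subspace_T \<alpha>_pos])
    fix w show "q1 (\<rho> w) *\<^sub>R ?V w \<in> T w"
      using subspace_T radial_field_T by (rule subspace_scale)
    fix u assume "u \<in> T w"
    then show "\<alpha> * (q1 (\<rho> w) *\<^sub>R ?V w \<bullet> u) = frechet_derivative (\<lambda>w. q (\<rho> w)) (at w) u"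
      unfolding frechet_derivative_at[OF der[OF q], symmetric]
      using radial_field_inner[of u w p] by (simp add: mult.left_commute[of \<alpha>])
  qed
  have dV: "((\<lambda>w. q1 (\<rho> w) *\<^sub>R ?V w) has_derivative
      (\<lambda>u. q1 (\<rho> w) *\<^sub>R D w u + (q2 (\<rho> w) * (- 2 * ((w - p) \<bullet> u))) *\<^sub>R ?V w)) (at w)"
    unfolding D_def
    by (rule has_derivative_scaleR[OF der[OF q1] smooth_map_has_derivative[OF smooth_radial_field]])
  have PT: "?P w v \<in> T w" for v by (simp add: kernel_proj_kernel[OF rank_J])
  \<comment> \<open>This identifies the differential of \<open>\<rho>\<close> on projected basis
    vectors with the coordinates of the field, so that the rank-one term of the derivative has trace
    \<alpha> times the squared Euclidean length.\<close>
  have inner_P: "- 2 * ((w - p) \<bullet> ?P w b) = \<alpha> * (?V w \<bullet> b)" for b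
  proof -
    have "?P w b \<bullet> ?V w = b \<bullet> ?V w"
      using radial_field_T[of p w] by (intro kernel_proj_inner) simp
    then show ?thesis
      using radial_field_inner[OF PT, of p b] by (metis inner_commute)
  qed
  have "laplace_beltrami T \<alpha> (\<lambda>w. q (\<rho> w)) w = (\<Sum>b\<in>Basis.
      (q1 (\<rho> w) *\<^sub>R D w (?P w b) + (q2 (\<rho> w) * (- 2 * ((w - p) \<bullet> ?P w b))) *\<^sub>R ?V w) \<bullet> b)"
  proof -
    have "riem_div T \<alpha> (\<lambda>w. q1 (\<rho> w) *\<^sub>R ?V w) w =
        (\<Sum>b\<in>Basis. frechet_derivative (\<lambda>w. q1 (\<rho> w) *\<^sub>R ?V w) (at w) (?P w b) \<bullet> b)"
    proof (rule riem_div_eq_trace)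
      show "?P w v \<bullet> u = v \<bullet> u" if "u \<in> T w" for u v
        using that by (simp add: kernel_proj_inner)
    qed (rule subspace_T \<alpha>_pos PT differentiableI[OF dV])+
    then show ?thesis
      unfolding laplace_beltrami_def grad frechet_derivative_at[OF dV, symmetric] .
  qed
  also have "\<dots> = (\<Sum>b\<in>Basis. q1 (\<rho> w) * (D w (?P w b) \<bullet> b) +
      q2 (\<rho> w) * (\<alpha> * ((?V w \<bullet> b) * (?V w \<bullet> b))))"
    unfolding inner_P by (simp add: inner_add_left mult_ac)
  also have "\<dots> = q1 (\<rho> w) * radial_div J \<alpha> p w + q2 (\<rho> w) * radial_energy J \<alpha> p w"
    unfolding radial_div_def radial_energy_def D_def[symmetric] euclidean_inner[of "?V w" "?V w"]
    by (simp add: sum.distrib sum_distrib_left)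
  finally show ?thesis .
qed

end

section \<open>A smooth bump function\<close>

text \<open>\<open>bump 0\<close> is the classical function exp(-1/r). The powers in the denominator
  make the family closed, up to linear combinations, under differentiation, so smoothness of all
  members follows by one induction.\<close>

definition bump :: "nat \<Rightarrow> real \<Rightarrow> real" where
  "bump n r = (if r \<le> 0 then 0 else exp (- inverse r) / r ^ n)"

lemma bump_nonneg: "bump n r \<ge> 0"
  by (simp add: bump_def)

lemma bump_derivative_0: "bump (n + 2) 0 - real n * bump (n + 1) 0 = 0"
  by (simp add: bump_def)

lemma bump_pos_iff: "bump n r > 0 \<longleftrightarrow> r > 0"
  by (simp add: bump_def)

lemma bump_tendsto_0: "(bump n \<longlongrightarrow> 0) (at 0)"
proof (rule filterlim_split_at)
  show "(bump n \<longlongrightarrow> 0) (at_left 0)"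
    by (rule tendsto_eventually) (auto simp: bump_def eventually_at_left_field intro: exI[of _ "-1"])
  \<comment> \<open>With x = 1/r tending to infinity this is the decay of x^n / exp(x).\<close>
  have "((\<lambda>r::real. inverse r ^ n / exp (inverse r)) \<longlongrightarrow> 0) (at_right 0)"
    by (rule filterlim_compose[OF tendsto_power_div_exp_0 filterlim_inverse_at_top_right])
  moreover have "\<forall>\<^sub>F r in at_right 0. inverse r ^ n / exp (inverse r) = bump n r"
    by (auto simp: eventually_at_right_field bump_def exp_minus field_simps intro!: exI[of _ 1])
  ultimately show "(bump n \<longlongrightarrow> 0) (at_right 0)"
    by (rule Lim_transform_eventually)
qed

lemma bump_has_derivative:
  "(bump n has_real_derivative bump (n + 2) r - n * bump (n + 1) r) (at r)"
proof -
  consider "r < 0" | "r = 0" | "r > 0" by linarith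
  then show ?thesis
  proof cases
    case 1
    have "((\<lambda>_. 0) has_real_derivative 0) (at r)" by simp
    then have "(bump n has_real_derivative 0) (at r)"
      by (rule DERIV_cong_ev[THEN iffD1, rotated -1])
        (use 1 in \<open>auto intro!: eventually_nhds_in_open[THEN eventually_mono, of "{..<0}"] simp: bump_def\<close>)
    with 1 show ?thesis by (simp add: bump_def)
  next
    case 2
    have "(bump n (0 + h) - bump n 0) / h = bump (n + 1) h" for h
      by (simp add: bump_def)
    then show ?thesis
      unfolding 2 DERIV_def using bump_tendsto_0[of "n + 1"] by (simp only: bump_derivative_0)
  next
    case 3
    have "((\<lambda>r. exp (- inverse r) * inverse r ^ n) has_real_derivative
        bump (n + 2) r - n * bump (n + 1) r) (at r)"
      using 3 by (cases n) (auto intro!: derivative_eq_intros simp: bump_def field_simps power2_eq_square,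
          metis power_eq_if One_nat_def)
    then show ?thesis
      by (rule DERIV_cong_ev[THEN iffD1, rotated -1])
        (use 3 in \<open>auto intro!: eventually_nhds_in_open[THEN eventually_mono, of "{0<..}"]
          simp: bump_def field_simps\<close>)
  qed
qed

lemma continuous_on_bump: "continuous_on A (bump n)"
  using bump_has_derivative by (meson DERIV_isCont continuous_at_imp_continuous_on)

lemma bump_bounded:
  obtains C where "\<And>r. r \<le> a \<Longrightarrow> \<bar>bump n r\<bar> \<le> C"
proof -
  have "bounded (bump n ` {0..a})"
    by (intro compact_imp_bounded compact_continuous_image continuous_on_bump) auto
  then obtain C where C: "C > 0" "\<And>x. x \<in> bump n ` {0..a} \<Longrightarrow> norm x \<le> C"
    using bounded_pos by metis
  have "\<bar>bump n r\<bar> \<le> C" if "r \<le> a" for r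
  proof (cases "r \<le> 0")
    case True then show ?thesis using C(1) by (simp add: bump_def)
  next
    case False then show ?thesis using C(2)[of "bump n r"] that by auto
  qed
  then show thesis by (rule that)
qed

lemma smooth_map_bump [smooth_intros]:
  assumes "smooth_map \<rho>"
  shows "smooth_map (\<lambda>w. bump n (\<rho> w))"
proof -
  have "times_cont_diff k (\<lambda>w. bump n (\<rho> w))" for k
  proof (induction k arbitrary: n)
    case 0
    show ?case
      using continuous_on_compose2[OF continuous_on_bump[of UNIV] smooth_map_continuous_on[OF assms]]
      by simp
  next
    case (Suc k)
    show ?case
    proof (rule times_cont_diff_SucI)
      show "((\<lambda>w. bump n (\<rho> w)) has_derivative
          (\<lambda>v. (bump (n + 2) (\<rho> w) - n * bump (n + 1) (\<rho> w)) * frechet_derivative \<rho> (at w) v)) (at w)" for w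
        using has_derivative_compose[OF smooth_map_has_derivative[OF assms]
            has_field_derivative_imp_has_derivative[OF bump_has_derivative]]
        by simp
      show "times_cont_diff k (\<lambda>w. (bump (n + 2) (\<rho> w) - n * bump (n + 1) (\<rho> w)) *
          frechet_derivative \<rho> (at w) v)" for v
        unfolding diff_conv_add_uminus
        by (intro times_cont_diff_bounded_bilinear[OF bounded_bilinear_mult] times_cont_diff_add
            times_cont_diff_bounded_linear[OF bounded_linear_minus[OF bounded_linear_ident]]
            times_cont_diff_const Suc.IH)
          (use smooth_map_frechet_derivative[OF assms] in \<open>simp add: smooth_map_def\<close>)
    qed
  qed
  then show ?thesis by (simp add: smooth_map_def)
qed

text \<open>The parameter \<open>a\<close> is the square of the radius of the ball on which the
  function is positive. In this parametrization, changing \<open>a\<close> merely translates the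
  argument of \<open>bump\<close>.\<close>

definition ball_bump :: "nat \<Rightarrow> 'a::euclidean_space \<Rightarrow> real \<Rightarrow> 'a \<Rightarrow> real" where
  "ball_bump n p a w = bump n (a - (w - p) \<bullet> (w - p))"

lemma ball_bump_eq_0: "norm (w - p) ^ 2 \<ge> a \<Longrightarrow> ball_bump n p a w = 0"
  by (simp add: ball_bump_def bump_def dot_square_norm)

lemma test_function_ball_bump: "test_function (ball_bump n p a)"
  unfolding test_function_def
proof
  show "smooth_map (ball_bump n p a)"
    unfolding ball_bump_def by (intro smooth_intros)
  have "{w. ball_bump n p a w \<noteq> 0} \<subseteq> cball p (sqrt a)"
  proof
    fix w assume "w \<in> {w. ball_bump n p a w \<noteq> 0}"
    then have "norm (w - p) ^ 2 \<le> a" using ball_bump_eq_0[of a w p n] by force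
    then show "w \<in> cball p (sqrt a)" by (simp add: dist_norm norm_minus_commute real_le_rsqrt)
  qed
  then show "compact (closure {w. ball_bump n p a w \<noteq> 0})"
    by (meson bounded_cball bounded_subset compact_closure)
qed

text \<open>The derivative \<open>bump 2\<close> of \<open>bump 0\<close> is Lipschitz below
  \<open>a\<close>, as its own derivative \<open>bump 4 - 2 * bump 3\<close> is bounded there. The
  lemma prices a decrease of the squared radius by \<open>d\<close> to first order.\<close>

lemma bump_taylor:
  obtains C where "C \<ge> 0"
    "\<And>r d. r \<le> a \<Longrightarrow> d \<ge> 0 \<Longrightarrow> bump 0 (r - d) \<ge> bump 0 r - d * bump 2 r - C * d\<^sup>2"
proof -
  obtain C3 C4 where C3: "\<And>r. r \<le> a \<Longrightarrow> \<bar>bump 3 r\<bar> \<le> C3" and C4: "\<And>r. r \<le> a \<Longrightarrow> \<bar>bump 4 r\<bar> \<le> C4"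
    using bump_bounded by metis
  define C where "C = C4 + 2 * C3"
  have d2: "(bump 2 has_real_derivative bump 4 r - 2 * bump 3 r) (at r)" for r
    using bump_has_derivative[of 2 r] by simp
  have lip: "\<bar>bump 2 r - bump 2 s\<bar> \<le> C * (r - s)" if "s \<le> r" "r \<le> a" for r s
  proof (cases "s = r")
    case False
    with that have "s < r" by simp
    from MVT2[OF this d2] obtain z
      where z: "s < z" "z < r" "bump 2 r - bump 2 s = (r - s) * (bump 4 z - 2 * bump 3 z)"
      by blast
    have "\<bar>bump 4 z - 2 * bump 3 z\<bar> \<le> C"
      using C3[of z] C4[of z] z that by (simp add: C_def)
    then show ?thesis using z that by (simp add: abs_mult mult_left_mono mult.commute)
  qed simp
  have C0: "C \<ge> 0"
    using C3[of a] C4[of a] by (simp add: C_def)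
  show thesis
  proof (rule that[OF C0])
    fix r d :: real assume r: "r \<le> a" "d \<ge> 0"
    show "bump 0 (r - d) \<ge> bump 0 r - d * bump 2 r - C * d\<^sup>2"
    proof (cases "d = 0")
      case False
      then obtain z where z: "r - d < z" "z < r" "bump 0 r - bump 0 (r - d) = d * bump 2 z"
        using MVT2[of "r - d" r "bump 0" "bump 2"] bump_has_derivative[of 0] r by (force simp: numeral_2_eq_2)
      have "bump 2 z \<le> bump 2 r + C * (r - z)" using lip[of z r] z r by auto
      also have "\<dots> \<le> bump 2 r + C * d" using z C0 by (simp add: mult_left_mono)
      finally have "d * bump 2 z \<le> d * (bump 2 r + C * d)" using r by (simp add: mult_left_mono)
      with z show ?thesis by (simp add: algebra_simps power2_eq_square)
    qed simp
  qed
qed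

section \<open>Expectations along the process\<close>

text \<open>Taking the floor plus one, not the ceiling, puts the grid points strictly to the right
  of \<open>r\<close>, as a limit along \<open>at_right\<close> demands.\<close>

lemma filterlim_ceil_grid_at_right:
  fixes r :: real
  shows "filterlim (\<lambda>n. (of_int \<lfloor>r * real (Suc n)\<rfloor> + 1) / real (Suc n)) (at_right r) sequentially"
proof -
  let ?g = "\<lambda>n. (of_int \<lfloor>r * real (Suc n)\<rfloor> + 1) / real (Suc n)"
  have gt: "r < ?g n" for n
    by (simp add: pos_less_divide_eq del: of_nat_Suc)
  have le: "?g n \<le> r + 1 / real (Suc n)" for n
    by (simp add: field_simps del: of_nat_Suc)
  have "(\<lambda>n. r + 1 / real (Suc n)) \<longlonglongrightarrow> r + 0"
    by (intro tendsto_intros LIMSEQ_Suc[OF lim_1_over_n])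
  then have "?g \<longlonglongrightarrow> r"
    by (intro tendsto_sandwich[of "\<lambda>_. r" ?g sequentially "\<lambda>n. r + 1 / real (Suc n)"])
      (auto intro!: always_eventually less_imp_le[OF gt] le simp del: of_nat_Suc)
  then show ?thesis
    by (intro tendsto_imp_filterlim_at_right) (auto intro!: always_eventually gt simp del: of_nat_Suc)
qed

text \<open>Replacing the time by the next grid point gives a process with countably many time
  values, which is jointly measurable; right continuity recovers the original as a limit. Joint
  measurability is needed for Fubini.\<close>

lemma measurable_right_continuous_process:
  fixes Y :: "real \<Rightarrow> 'p \<Rightarrow> real"
  assumes Y: "\<And>r. r \<ge> 0 \<Longrightarrow> Y r \<in> borel_measurable N"
    and cont: "\<And>\<omega> r. \<omega> \<in> space N \<Longrightarrow> r \<ge> 0 \<Longrightarrow> ((\<lambda>s. Y s \<omega>) \<longlongrightarrow> Y r \<omega>) (at_right r)"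
  shows "(\<lambda>(r, \<omega>). indicator {0..} r * Y r \<omega>) \<in> borel_measurable (lborel \<Otimes>\<^sub>M N)"
proof -
  \<comment> \<open>The conversion to \<open>nat\<close> keeps every grid time positive, also for
    negative \<open>r\<close>, where the indicator discards the value.\<close>
  let ?g = "\<lambda>n r. (real (nat \<lfloor>r * real (Suc n)\<rfloor>) + 1) / real (Suc n)"
  have g: "((\<lambda>n. Y (?g n r) \<omega>) \<longlonglongrightarrow> Y r \<omega>)" if "\<omega> \<in> space N" "r \<ge> 0" for r \<omega>
  proof -
    have "?g n r = (of_int \<lfloor>r * real (Suc n)\<rfloor> + 1) / real (Suc n)" for n
      using that(2) by simp
    then show ?thesis
      using filterlim_compose[OF cont[OF that] filterlim_ceil_grid_at_right] by (simp only:)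
  qed
  have "(\<lambda>p. Y (?g n (fst p)) (snd p)) \<in> borel_measurable (lborel \<Otimes>\<^sub>M N)" for n
  proof (rule measurable_compose_countable[where g = "\<lambda>p. nat \<lfloor>fst p * real (Suc n)\<rfloor>"])
    show "(\<lambda>p. Y ((real i + 1) / real (Suc n)) (snd p)) \<in> borel_measurable (lborel \<Otimes>\<^sub>M N)" for i :: nat
      by (rule measurable_compose[OF measurable_snd Y]) simp
  qed measurable
  then have "(\<lambda>p. indicator {0..} (fst p) * Y (?g n (fst p)) (snd p)) \<in> borel_measurable (lborel \<Otimes>\<^sub>M N)" for n
    by measurable
  then have "(\<lambda>p. indicator {0..} (fst p) * Y (fst p) (snd p)) \<in> borel_measurable (lborel \<Otimes>\<^sub>M N)"
  proof (rule borel_measurable_LIMSEQ_real[rotated])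
    fix p :: "real \<times> 'p" assume "p \<in> space (lborel \<Otimes>\<^sub>M N)"
    then have "snd p \<in> space N" by (auto simp: space_pair_measure)
    then show "(\<lambda>n. indicator {0..} (fst p) * Y (?g n (fst p)) (snd p))
        \<longlonglongrightarrow> indicator {0..} (fst p) * Y (fst p) (snd p)"
      using g[of "snd p" "fst p"] by (auto simp: indicator_def intro: tendsto_const)
  qed
  then show ?thesis by (simp add: case_prod_unfold)
qed

section \<open>Expectations of functions of the living process\<close>

locale brownian_motion =
  fixes M :: "'a::euclidean_space set" and T :: "'a \<Rightarrow> 'a set" and \<alpha> :: real and w0 :: 'a
    and \<Omega> :: "'p measure" and F :: "real \<Rightarrow> 'p measure"
    and X :: "real \<Rightarrow> 'p \<Rightarrow> 'a" and \<zeta> :: "'p \<Rightarrow> ereal"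
  assumes rbm: "riemannian_brownian_motion M T \<alpha> w0 \<Omega> F X \<zeta>"
begin

sublocale prob_space \<Omega>
  using rbm by (simp add: riemannian_brownian_motion_def)

lemma subalgebra_F: "subalgebra \<Omega> (F s)"
  using rbm by (simp add: riemannian_brownian_motion_def)

lemma measurable_X: "s \<ge> 0 \<Longrightarrow> X s \<in> borel_measurable \<Omega>"
  by (rule measurable_from_subalg[OF subalgebra_F[of s]])
    (use rbm in \<open>simp add: riemannian_brownian_motion_def\<close>)

lemma pred_alive: "s \<ge> 0 \<Longrightarrow> Measurable.pred \<Omega> (\<lambda>\<omega>. ereal s < \<zeta> \<omega>)"
proof -
  assume "s \<ge> 0"
  then have "Measurable.pred (F s) (\<lambda>\<omega>. \<zeta> \<omega> \<le> ereal s)"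
    using rbm by (auto simp: riemannian_brownian_motion_def)
  then have [measurable]: "Measurable.pred \<Omega> (\<lambda>\<omega>. \<zeta> \<omega> \<le> ereal s)"
    by (rule measurable_from_subalg[OF subalgebra_F])
  have "Measurable.pred \<Omega> (\<lambda>\<omega>. \<not> \<zeta> \<omega> \<le> ereal s)"
    by measurable
  then show ?thesis by (simp add: not_le)
qed

lemma path:
  assumes "\<omega> \<in> space \<Omega>"
  shows "0 < \<zeta> \<omega>" "X 0 \<omega> = w0" "\<And>s. s \<ge> 0 \<Longrightarrow> ereal s < \<zeta> \<omega> \<Longrightarrow> X s \<omega> \<in> M"
    "continuous_on {s. 0 \<le> s \<and> ereal s < \<zeta> \<omega>} (\<lambda>s. X s \<omega>)"
  using rbm assms by (auto simp: riemannian_brownian_motion_def)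

text \<open>Extension by 0 after the lifetime. Thus \<open>mean\<close> integrates against the
  sub-probability law of the process while it lives, without the normalization of
  \<open>law_at\<close>.\<close>

definition alive :: "('a \<Rightarrow> real) \<Rightarrow> real \<Rightarrow> 'p \<Rightarrow> real" where
  "alive \<phi> s \<omega> = (if ereal s < \<zeta> \<omega> then \<phi> (X s \<omega>) else 0)"

definition mean :: "('a \<Rightarrow> real) \<Rightarrow> real \<Rightarrow> real" where
  "mean \<phi> s = expectation (alive \<phi> s)"

lemma measurable_alive:
  assumes "continuous_on UNIV \<phi>" "s \<ge> 0"
  shows "alive \<phi> s \<in> borel_measurable \<Omega>"
proof -
  note [measurable] = borel_measurable_continuous_onI[OF assms(1)] measurable_X[OF assms(2)] pred_alive[OF assms(2)]
  show ?thesis unfolding alive_def by measurable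
qed

lemma alive_bound:
  assumes "\<And>x. x \<in> M \<Longrightarrow> \<bar>\<phi> x\<bar> \<le> C" "C \<ge> 0" "s \<ge> 0" "\<omega> \<in> space \<Omega>"
  shows "\<bar>alive \<phi> s \<omega>\<bar> \<le> C"
  using assms path(3) by (simp add: alive_def)

lemma integrable_alive:
  assumes "continuous_on UNIV \<phi>" "s \<ge> 0" "\<And>x. x \<in> M \<Longrightarrow> \<bar>\<phi> x\<bar> \<le> C"
  shows "integrable \<Omega> (alive \<phi> s)"
proof (rule integrable_const_bound[OF _ measurable_alive])
  show "AE \<omega> in \<Omega>. norm (alive \<phi> s \<omega>) \<le> max C 0"
    unfolding real_norm_def
    by (intro AE_I2 alive_bound assms(2) order.trans[OF assms(3) max.cobounded1] max.cobounded2)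
qed (use assms in auto)

lemma mean_bound:
  assumes "continuous_on UNIV \<phi>" "s \<ge> 0" "\<And>x. x \<in> M \<Longrightarrow> \<bar>\<phi> x\<bar> \<le> C" "C \<ge> 0"
  shows "\<bar>mean \<phi> s\<bar> \<le> C"
proof -
  have "\<bar>mean \<phi> s\<bar> \<le> expectation (\<lambda>\<omega>. \<bar>alive \<phi> s \<omega>\<bar>)"
    unfolding mean_def by (rule integral_abs_bound)
  also have "\<dots> \<le> C"
    using assms by (intro integral_le_const integrable_abs integrable_alive AE_I2 alive_bound)
  finally show ?thesis .
qed

lemma mean_mono:
  assumes "continuous_on UNIV \<phi>" "continuous_on UNIV \<psi>" "s \<ge> 0"
    "\<And>x. x \<in> M \<Longrightarrow> \<bar>\<phi> x\<bar> \<le> C" "\<And>x. x \<in> M \<Longrightarrow> \<bar>\<psi> x\<bar> \<le> D" "\<And>x. x \<in> M \<Longrightarrow> \<phi> x \<le> \<psi> x"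
  shows "mean \<phi> s \<le> mean \<psi> s"
  unfolding mean_def
  by (intro integral_mono integrable_alive[where C=C] integrable_alive[where C=D] assms)
    (auto simp: alive_def intro!: assms path(3))

lemma mean_add_cmult:
  assumes "continuous_on UNIV \<phi>" "continuous_on UNIV \<psi>" "s \<ge> 0"
    "\<And>x. x \<in> M \<Longrightarrow> \<bar>\<phi> x\<bar> \<le> C" "\<And>x. x \<in> M \<Longrightarrow> \<bar>\<psi> x\<bar> \<le> D"
  shows "mean (\<lambda>x. \<phi> x + c * \<psi> x) s = mean \<phi> s + c * mean \<psi> s"
proof -
  have "alive (\<lambda>x. \<phi> x + c * \<psi> x) s \<omega> = alive \<phi> s \<omega> + c * alive \<psi> s \<omega>" for \<omega>
    by (simp add: alive_def)
  then have "mean (\<lambda>x. \<phi> x + c * \<psi> x) s = expectation (\<lambda>\<omega>. alive \<phi> s \<omega> + c * alive \<psi> s \<omega>)"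
    unfolding mean_def by presburger
  also have "\<dots> = mean \<phi> s + c * mean \<psi> s"
    unfolding mean_def
    using integrable_alive[of \<phi> s C] integrable_alive[of \<psi> s D] assms by simp
  finally show ?thesis .
qed

text \<open>Before the lifetime the path is continuous and stays alive for a short while; from the
  lifetime on, including the lifetime itself, the value is constantly 0.\<close>

lemma alive_right_continuous:
  assumes "continuous_on UNIV \<phi>" "\<omega> \<in> space \<Omega>" "r \<ge> 0"
  shows "((\<lambda>s. alive \<phi> s \<omega>) \<longlongrightarrow> alive \<phi> r \<omega>) (at_right r)"
proof (cases "ereal r < \<zeta> \<omega>")
  case True
  let ?S = "{s. 0 \<le> s \<and> ereal s < \<zeta> \<omega>}"
  obtain u where u: "r < u" "ereal u < \<zeta> \<omega>"
    using ereal_dense2[OF True] by auto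
  have ev: "\<forall>\<^sub>F s in at_right r. s \<in> ?S"
    unfolding eventually_at_right_field using u assms(3)
    by (intro exI[of _ u]) (auto intro: order.strict_trans[of _ "ereal u"])
  have "continuous_on ?S (\<lambda>s. \<phi> (X s \<omega>))"
    by (rule continuous_on_compose2[OF assms(1) path(4)[OF assms(2)]]) auto
  then have "((\<lambda>s. \<phi> (X s \<omega>)) \<longlongrightarrow> \<phi> (X r \<omega>)) (at r within ?S)"
    using True assms(3) by (auto simp: continuous_on_def)
  moreover have "at_right r \<le> at r within ?S"
  proof (rule filter_leI)
    fix P assume "eventually P (at r within ?S)"
    then show "eventually P (at_right r)"
      using ev unfolding eventually_at_filter
      by (auto simp: eventually_at_filter elim: eventually_elim2)
  qed
  ultimately have "((\<lambda>s. \<phi> (X s \<omega>)) \<longlongrightarrow> \<phi> (X r \<omega>)) (at_right r)"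
    by (rule tendsto_mono[rotated])
  moreover have "\<forall>\<^sub>F s in at_right r. \<phi> (X s \<omega>) = alive \<phi> s \<omega>"
    using ev by eventually_elim (simp add: alive_def)
  ultimately show ?thesis
    using True by (simp add: alive_def[of _ r] Lim_transform_eventually)
next
  case False
  have "\<forall>\<^sub>F s in at_right r. 0 = alive \<phi> s \<omega>"
    unfolding eventually_at_right_field using False
    by (intro exI[of _ "r + 1"]) (auto simp: alive_def not_less dest: less_le_trans)
  then have "((\<lambda>s. alive \<phi> s \<omega>) \<longlongrightarrow> 0) (at_right r)"
    by (rule Lim_transform_eventually[OF tendsto_const])
  with False show ?thesis by (simp add: alive_def)
qed

end

lemma test_function_continuous: "test_function \<phi> \<Longrightarrow> continuous_on A \<phi>"
  by (simp add: test_function_def smooth_map_continuous_on)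

lemma test_function_bounded:
  assumes "test_function \<phi>"
  obtains C where "C \<ge> 0" "\<And>x. \<bar>\<phi> x\<bar> \<le> C"
proof -
  have "bounded (\<phi> ` closure {w. \<phi> w \<noteq> 0})"
    using assms by (intro compact_imp_bounded compact_continuous_image test_function_continuous)
      (auto simp: test_function_def)
  then obtain C where C: "C > 0" "\<And>x. x \<in> closure {w. \<phi> w \<noteq> 0} \<Longrightarrow> norm (\<phi> x) \<le> C"
    unfolding bounded_pos by blast
  have "\<bar>\<phi> x\<bar> \<le> C" for x
    using C closure_subset[of "{w. \<phi> w \<noteq> 0}"] by (cases "\<phi> x = 0") auto
  then show thesis using C(1) that[of C] by auto
qed

section \<open>Dynkin's formula and its incremental form\<close>

context brownian_motion
begin

lemma integrable_pair_alive:
  assumes "continuous_on UNIV \<psi>" "\<And>x. x \<in> M \<Longrightarrow> \<bar>\<psi> x\<bar> \<le> C"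
  shows "integrable (lborel \<Otimes>\<^sub>M \<Omega>) (\<lambda>(r, \<omega>). indicator {0..s} r * alive \<psi> r \<omega>)"
proof (rule Bochner_Integration.integrable_bound)
  have "emeasure (lborel \<Otimes>\<^sub>M \<Omega>) ({0..s} \<times> space \<Omega>) < \<infinity>"
    by (subst emeasure_pair_measure_Times) (auto simp: emeasure_space_1 emeasure_lborel_Icc_eq)
  then show "integrable (lborel \<Otimes>\<^sub>M \<Omega>) (\<lambda>p. max C 0 * indicator ({0..s} \<times> space \<Omega>) p :: real)"
    by (intro integrable_mult_right integrable_real_indicator) auto
  have "(\<lambda>p. indicator {..s} (fst p) * (case p of (r, \<omega>) \<Rightarrow> indicator {0..} r * alive \<psi> r \<omega>))
      \<in> borel_measurable (lborel \<Otimes>\<^sub>M \<Omega>)"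
    by (intro borel_measurable_times measurable_right_continuous_process measurable_alive
        alive_right_continuous assms) measurable
  also have "(\<lambda>p. indicator {..s} (fst p) * (case p of (r, \<omega>) \<Rightarrow> indicator {0..} r * alive \<psi> r \<omega>)) =
      (\<lambda>(r, \<omega>). indicator {0..s} r * alive \<psi> r \<omega>)"
    by (auto simp: indicator_def)
  finally show "(\<lambda>(r, \<omega>). indicator {0..s} r * alive \<psi> r \<omega>) \<in> borel_measurable (lborel \<Otimes>\<^sub>M \<Omega>)" .
  have "\<bar>alive \<psi> r \<omega>\<bar> \<le> max C 0" if "\<omega> \<in> space \<Omega>" "r \<ge> 0" for r \<omega>
    by (intro alive_bound that order.trans[OF assms(2) max.cobounded1] max.cobounded2)
  then show "AE p in lborel \<Otimes>\<^sub>M \<Omega>. norm (case p of (r, \<omega>) \<Rightarrow> indicator {0..s} r * alive \<psi> r \<omega>)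
      \<le> norm (max C 0 * indicator ({0..s} \<times> space \<Omega>) p :: real)"
    by (intro AE_I2) (auto simp: space_pair_measure indicator_def)
qed

text \<open>Dynkin's formula: the martingale of the martingale problem starts at 0, so its
  expectation vanishes at every time, and Fubini moves the expectation inside the time
  integral.\<close>

lemma mean_eq:
  assumes \<phi>: "test_function \<phi>" and \<psi>: "\<And>w. 1/2 * laplace_beltrami T \<alpha> \<phi> w = \<psi> w"
    and cont: "continuous_on UNIV \<psi>" and bound: "\<And>x. x \<in> M \<Longrightarrow> \<bar>\<psi> x\<bar> \<le> C" and "s \<ge> 0"
  shows "mean \<phi> s = \<phi> w0 + (\<integral>r. indicator {0..s} r * mean \<psi> r \<partial>lborel)"
    and "integrable lborel (\<lambda>r. indicator {0..s} r * mean \<psi> r)"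
proof -
  interpret P: pair_sigma_finite lborel \<Omega> ..
  define N where "N s \<omega> = alive \<phi> s \<omega> - \<phi> (X 0 \<omega>) - (\<integral>r. indicator {0..s} r * alive \<psi> r \<omega> \<partial>lborel)" for s \<omega>
  have set: "indicator {r. 0 \<le> r \<and> r \<le> s \<and> ereal r < \<zeta> \<omega>} r *\<^sub>R \<psi> (X r \<omega>) =
      indicator {0..s} r * alive \<psi> r \<omega>" for r s \<omega>
    by (auto simp: indicator_def alive_def)
  have "martingale \<Omega> F (\<lambda>s \<omega>.
          (if ereal s < \<zeta> \<omega> then \<phi> (X s \<omega>) else 0) - \<phi> (X 0 \<omega>) -
          (LINT r:{r. 0 \<le> r \<and> r \<le> s \<and> ereal r < \<zeta> \<omega>}|lborel.
             (1/2) * laplace_beltrami T \<alpha> \<phi> (X r \<omega>)))"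
    using rbm \<phi> unfolding riemannian_brownian_motion_def by blast
  then have mart: "martingale \<Omega> F N"
    unfolding \<psi> set_lebesgue_integral_def set alive_def[symmetric] N_def[symmetric] .
  obtain B where B: "\<And>x. \<bar>\<phi> x\<bar> \<le> B" using test_function_bounded[OF \<phi>] by metis
  note int\<phi> = integrable_alive[OF test_function_continuous[OF \<phi>] \<open>s \<ge> 0\<close> B]
  interpret S: finite_measure_subalgebra \<Omega> "F 0"
    by standard (rule subalgebra_F)
  have intN: "integrable \<Omega> (N s)" and AE: "AE \<omega> in \<Omega>. real_cond_exp \<Omega> (F 0) (N s) \<omega> = N 0 \<omega>"
    using mart \<open>s \<ge> 0\<close> unfolding martingale_def by auto
  have "expectation (N s) = expectation (real_cond_exp \<Omega> (F 0) (N s))"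
    using S.real_cond_exp_int(2)[OF intN] by simp
  also have "\<dots> = expectation (N 0)"
    using AE intN mart by (intro integral_cong_AE) (auto simp: martingale_def)
  \<comment> \<open>At time 0 the time integral runs over a null set, and the two values of
    \<open>\<phi>\<close> cancel because the lifetime is positive.\<close>
  also have "\<dots> = expectation (\<lambda>_. 0)"
  proof (rule Bochner_Integration.integral_cong[OF refl])
    fix \<omega> assume \<omega>: "\<omega> \<in> space \<Omega>"
    have "AE r in lborel. r \<noteq> (0::real)" by (rule AE_lborel_singleton)
    then have "AE r in lborel. indicator {0..0} r * alive \<psi> r \<omega> = 0"
      by eventually_elim (auto simp: indicator_def)
    then have "(\<integral>r. indicator {0..0} r * alive \<psi> r \<omega> \<partial>lborel) = 0"
      by (rule integral_eq_zero_AE)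
    then show "N 0 \<omega> = 0"
      using path(1)[OF \<omega>] by (simp add: N_def alive_def zero_ereal_def)
  qed
  finally have "expectation (N s) = 0" by simp
  note ip = integrable_pair_alive[OF cont bound, of s]
  have "integrable \<Omega> (\<lambda>\<omega>. \<integral>r. indicator {0..s} r * alive \<psi> r \<omega> \<partial>lborel)"
    using P.integrable_snd[OF ip] by simp
  moreover have "(\<integral>\<omega>. (\<integral>r. indicator {0..s} r * alive \<psi> r \<omega> \<partial>lborel) \<partial>\<Omega>) =
      (\<integral>r. (\<integral>\<omega>. indicator {0..s} r * alive \<psi> r \<omega> \<partial>\<Omega>) \<partial>lborel)"
    by (rule P.Fubini_integral[OF ip])
  moreover have "expectation (N s) = expectation (\<lambda>\<omega>. alive \<phi> s \<omega> - \<phi> w0 -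
      (\<integral>r. indicator {0..s} r * alive \<psi> r \<omega> \<partial>lborel))"
    by (intro Bochner_Integration.integral_cong) (auto simp: N_def path)
  ultimately show "mean \<phi> s = \<phi> w0 + (\<integral>r. indicator {0..s} r * mean \<psi> r \<partial>lborel)"
    using int\<phi> \<open>expectation (N s) = 0\<close> by (simp add: mean_def prob_space)
  show "integrable lborel (\<lambda>r. indicator {0..s} r * mean \<psi> r)"
    using P.integrable_fst[OF ip] by (simp add: mean_def)
qed

text \<open>Subtracting Dynkin's formula at two times leaves an integral over the interval between
  them. Uniform bounds on the integrand then play the part of a derivative in time.\<close>

lemma mean_increment:
  assumes \<phi>: "test_function \<phi>" and \<psi>: "\<And>w. 1/2 * laplace_beltrami T \<alpha> \<phi> w = \<psi> w"
    and cont: "continuous_on UNIV \<psi>" and bound: "\<And>x. x \<in> M \<Longrightarrow> \<bar>\<psi> x\<bar> \<le> C"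
    and s: "0 \<le> s" "s \<le> s'"
  shows "(\<And>r. s \<le> r \<Longrightarrow> r \<le> s' \<Longrightarrow> c \<le> mean \<psi> r) \<Longrightarrow> c * (s' - s) \<le> mean \<phi> s' - mean \<phi> s"
    and "(\<And>r. s \<le> r \<Longrightarrow> r \<le> s' \<Longrightarrow> mean \<psi> r \<le> c) \<Longrightarrow> mean \<phi> s' - mean \<phi> s \<le> c * (s' - s)"
proof -
  have "0 \<le> s'" using s by simp
  note m = mean_eq[OF \<phi> \<psi> cont bound \<open>0 \<le> s\<close>] and m' = mean_eq[OF \<phi> \<psi> cont bound \<open>0 \<le> s'\<close>]
  have ind: "indicator {0..s'} r * mean \<psi> r - indicator {0..s} r * mean \<psi> r =
      indicator {s<..s'} r * mean \<psi> r" for r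
    using s by (auto simp: indicator_def)
  have eq: "mean \<phi> s' - mean \<phi> s = (\<integral>r. indicator {s<..s'} r * mean \<psi> r \<partial>lborel)"
    using m(1) m'(1) Bochner_Integration.integral_diff[OF m'(2) m(2)] unfolding ind by linarith
  have int: "integrable lborel (\<lambda>r. indicator {s<..s'} r * mean \<psi> r)"
    unfolding ind[symmetric] by (rule Bochner_Integration.integrable_diff[OF m'(2) m(2)])
  have c: "integrable lborel (\<lambda>r. indicator {s<..s'} r * c)"
      "(\<integral>r. indicator {s<..s'} r * c \<partial>lborel) = c * (s' - s)"
    using s by (auto simp: emeasure_lborel_Ioc)
  show "c * (s' - s) \<le> mean \<phi> s' - mean \<phi> s" if "\<And>r. s \<le> r \<Longrightarrow> r \<le> s' \<Longrightarrow> c \<le> mean \<psi> r"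
    unfolding eq c(2)[symmetric] using that
    by (intro integral_mono c int) (auto simp: indicator_def)
  show "mean \<phi> s' - mean \<phi> s \<le> c * (s' - s)" if "\<And>r. s \<le> r \<Longrightarrow> r \<le> s' \<Longrightarrow> mean \<psi> r \<le> c"
    unfolding eq c(2)[symmetric] using that
    by (intro integral_mono c int) (auto simp: indicator_def)
qed

end

section \<open>The moving barrier\<close>

text \<open>For \<open>\<rho> \<le> \<delta>\<close> the second-order term \<open>\<Gamma>\<close> dominates, for \<open>\<rho> \<ge> \<delta>\<close> the term with \<open>k\<close> does.\<close>

lemma barrier_poly:
  fixes a0 b D E c0 d :: real
  assumes "b \<ge> 0" "D \<ge> 0" "E \<ge> 0" "c0 > 0" "d > 0" "a0 > 0"
  obtains k where "k \<ge> 0"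
    "\<And>\<rho> \<Lambda> \<Gamma>. 0 < \<rho> \<Longrightarrow> \<rho> \<le> a0 \<Longrightarrow> \<bar>\<Lambda>\<bar> \<le> D \<Longrightarrow> 0 \<le> \<Gamma> \<Longrightarrow> \<Gamma> \<le> E \<Longrightarrow> (\<rho> \<le> d \<Longrightarrow> c0 \<le> \<Gamma>) \<Longrightarrow>
      0 \<le> \<rho>\<^sup>2 * \<Lambda> / 2 + (1 - 2 * \<rho>) * \<Gamma> / 2 - b * \<rho>\<^sup>2 + k * \<rho> ^ 4"
proof -
  \<comment> \<open>The bound 1/4 gives \<open>1 - 2 * \<rho> \<ge> 1/2\<close>; the last bound
    keeps \<open>\<rho>\<^sup>2 * (D + b)\<close> below \<open>c0 / 4\<close>, so the second-order
    term wins.\<close>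
  define \<delta> where "\<delta> = min d (min (1/4) (c0 / (4 * (D + b + 1))))"
  \<comment> \<open>Beyond \<open>\<delta>\<close> the fourth power is at least
    \<open>\<delta> ^ 4\<close>, so this \<open>k\<close> dominates crude bounds for all the
    negative terms.\<close>
  define k where "k = (D * a0\<^sup>2 + a0 * E + b * a0\<^sup>2) / \<delta> ^ 4"
  have \<delta>: "\<delta> > 0" using assms by (auto simp: \<delta>_def)
  have k: "k \<ge> 0" using assms \<delta> by (auto simp: k_def)
  show thesis
  proof (rule that[OF k])
    fix \<rho> \<Lambda> \<Gamma> :: real
    assume *: "0 < \<rho>" "\<rho> \<le> a0" "\<bar>\<Lambda>\<bar> \<le> D" "0 \<le> \<Gamma>" "\<Gamma> \<le> E" "\<rho> \<le> d \<Longrightarrow> c0 \<le> \<Gamma>"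
    have \<Lambda>: "\<rho>\<^sup>2 * \<Lambda> \<ge> - (\<rho>\<^sup>2 * D)"
      using mult_left_mono[of "- D" \<Lambda> "\<rho>\<^sup>2"] *(3) by simp
    show "0 \<le> \<rho>\<^sup>2 * \<Lambda> / 2 + (1 - 2 * \<rho>) * \<Gamma> / 2 - b * \<rho>\<^sup>2 + k * \<rho> ^ 4"
    proof (cases "\<rho> \<le> \<delta>")
      case True
      then have \<rho>: "\<rho> \<le> d" "\<rho> \<le> 1/4" "\<rho> \<le> c0 / (4 * (D + b + 1))" by (auto simp: \<delta>_def)
      have "(1 - 2 * \<rho>) * \<Gamma> \<ge> 1/2 * c0"
        using *(6)[OF \<rho>(1)] \<rho>(2) assms by (intro mult_mono) auto
      moreover have "\<rho>\<^sup>2 * (D + b) \<le> c0 / 4"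
      proof -
        have "\<rho>\<^sup>2 * (D + b) \<le> \<rho> * (D + b + 1)"
          using * \<rho> assms by (intro mult_mono) (auto simp: power2_eq_square intro: mult_left_le)
        also have "\<dots> \<le> c0 / 4" using \<rho>(3) assms by (simp add: field_simps)
        finally show ?thesis .
      qed
      moreover have "k * \<rho> ^ 4 \<ge> 0" "\<rho>\<^sup>2 * D \<ge> 0" using k * assms by auto
      moreover have "\<rho>\<^sup>2 * (D + b) = \<rho>\<^sup>2 * D + b * \<rho>\<^sup>2" by (simp add: algebra_simps)
      ultimately show ?thesis using \<Lambda> by linarith
    next
      case False
      have "\<rho>\<^sup>2 \<le> a0\<^sup>2" using * by (intro power_mono) auto
      then have "\<rho>\<^sup>2 * D \<le> a0\<^sup>2 * D" "b * \<rho>\<^sup>2 \<le> b * a0\<^sup>2"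
        using assms by (auto intro: mult_right_mono mult_left_mono)
      moreover have "\<rho> * \<Gamma> \<le> a0 * E" using * assms by (intro mult_mono) auto
      moreover have "k * \<rho> ^ 4 \<ge> D * a0\<^sup>2 + a0 * E + b * a0\<^sup>2"
      proof -
        have "k * \<rho> ^ 4 \<ge> k * \<delta> ^ 4" using False k \<delta> by (intro mult_left_mono power_mono) auto
        then show ?thesis using \<delta> by (simp add: k_def)
      qed
      moreover have "0 \<le> a0\<^sup>2 * D" "D * a0\<^sup>2 = a0\<^sup>2 * D" using assms by auto
      moreover have "(1 - 2 * \<rho>) * \<Gamma> = \<Gamma> - 2 * (\<rho> * \<Gamma>)" by (simp add: algebra_simps)
      ultimately show ?thesis using \<Lambda> *(4) by linarith
    qed
  qed
qed

text \<open>A discrete Gronwall argument over \<open>n\<close> equal steps. The local errors of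
  order 1/n^2 add up to at most \<open>K * \<tau>\<^sup>2 / n\<close>, and the damping factors
  multiply to a quantity tending to exp(-k \<tau>), so the limit bounds \<open>v\<close> below by
  exp(-k \<tau>) times \<open>u0\<close>.\<close>

lemma discrete_growth:
  fixes u :: "nat \<Rightarrow> nat \<Rightarrow> real" and k K \<tau> u0 :: real
  assumes "k \<ge> 0" "K \<ge> 0" "\<tau> > 0" "u0 > 0"
    and start: "\<And>n. u n 0 = u0" and fin: "\<And>n. n > 0 \<Longrightarrow> u n n = v"
    and step: "\<And>n i. i < n \<Longrightarrow> (1 - k * (\<tau> / n)) * u n i - K * (\<tau> / n)\<^sup>2 \<le> u n (Suc i)"
  shows "v > 0"
proof -
  \<comment> \<open>Requiring \<open>n \<ge> k * \<tau>\<close> makes the damping factor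
    nonnegative, so that inequalities may be multiplied by it.\<close>
  have main: "(1 + (- (k * \<tau>)) / n) ^ n * u0 - K * \<tau>\<^sup>2 / n \<le> v" if n: "n > 0" "real n \<ge> k * \<tau>" for n :: nat
  proof -
    let ?q = "1 - k * (\<tau> / n)"
    have q: "0 \<le> ?q" "?q \<le> 1" using n assms by (auto simp: field_simps)
    have "?q ^ i * u0 - i * (K * (\<tau> / n)\<^sup>2) \<le> u n i" if "i \<le> n" for i
      using that
    proof (induction i)
      case (Suc i)
      have "?q ^ Suc i * u0 - Suc i * (K * (\<tau> / n)\<^sup>2) \<le>
          ?q * (?q ^ i * u0 - i * (K * (\<tau> / n)\<^sup>2)) - K * (\<tau> / n)\<^sup>2"
      proof -
        have "?q * (i * (K * (\<tau> / n)\<^sup>2)) \<le> 1 * (i * (K * (\<tau> / n)\<^sup>2))"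
          using q assms by (intro mult_right_mono) auto
        then show ?thesis by (simp add: right_diff_distrib distrib_right)
      qed
      also have "\<dots> \<le> ?q * u n i - K * (\<tau> / n)\<^sup>2"
        using Suc q by (intro diff_right_mono mult_left_mono) auto
      also have "\<dots> \<le> u n (Suc i)" using step Suc.prems by simp
      finally show ?case .
    qed (simp add: start)
    from this[of n] show ?thesis
      using n by (simp add: fin field_simps power2_eq_square)
  qed
  have "\<forall>\<^sub>F n in sequentially. (1 + (- (k * \<tau>)) / real n) ^ n * u0 - K * \<tau>\<^sup>2 / real n \<le> v"
    using eventually_gt_at_top[of "0::nat"] filterlim_real_sequentially[unfolded filterlim_at_top, rule_format, of "k * \<tau>"]
    by eventually_elim (rule main)
  moreover have "(\<lambda>n. (1 + (- (k * \<tau>)) / real n) ^ n * u0 - K * \<tau>\<^sup>2 / real n)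
      \<longlonglongrightarrow> exp (- (k * \<tau>)) * u0 - 0"
    by (intro tendsto_intros tendsto_exp_limit_sequentially lim_const_over_n)
  ultimately have "exp (- (k * \<tau>)) * u0 - 0 \<le> v"
    by (intro tendsto_upperbound) auto
  moreover have "0 < exp (- (k * \<tau>)) * u0" using \<open>u0 > 0\<close> by simp
  ultimately show ?thesis by linarith
qed

lemma abs_diff_mult_le:
  fixes x y c :: real
  shows "\<bar>x\<bar> \<le> A \<Longrightarrow> \<bar>y\<bar> \<le> B \<Longrightarrow> 0 \<le> c \<Longrightarrow> \<bar>x - c * y\<bar> \<le> A + c * B"
  using abs_triangle_ineq4[of x "c * y"] mult_left_mono[of "\<bar>y\<bar>" B c] by (simp add: abs_mult)

lemma abs_add_mult_le:
  fixes u v x y :: real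
  shows "\<bar>u\<bar> \<le> A \<Longrightarrow> \<bar>v\<bar> \<le> B \<Longrightarrow> \<bar>u * x + v * y\<bar> \<le> A * \<bar>x\<bar> + B * \<bar>y\<bar>"
  using abs_triangle_ineq[of "u * x" "v * y"] mult_right_mono[of "\<bar>u\<bar>" A "\<bar>x\<bar>"]
    mult_right_mono[of "\<bar>v\<bar>" B "\<bar>y\<bar>"] by (simp add: abs_mult)

section \<open>The generator on ball bumps and the barrier inequality\<close>

context full_rank_field
begin

text \<open>Half the Laplacian of a ball bump, with both derivatives of \<open>bump n\<close>
  written out. In this form continuity and bounds can be read off.\<close>

definition bump_generator :: "nat \<Rightarrow> real^'d \<Rightarrow> real \<Rightarrow> real^'d \<Rightarrow> real" where
  "bump_generator n p a w = (let \<rho> = a - (w - p) \<bullet> (w - p) in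
     ((bump (n + 2) \<rho> - n * bump (n + 1) \<rho>) * radial_div J \<alpha> p w +
      ((bump (n + 4) \<rho> - (n + 2) * bump (n + 3) \<rho>) - n * (bump (n + 3) \<rho> - (n + 1) * bump (n + 2) \<rho>)) *
        radial_energy J \<alpha> p w) / 2)"

lemma half_laplace_ball_bump:
  "1/2 * laplace_beltrami T \<alpha> (ball_bump n p a) w = bump_generator n p a w"
proof -
  have "((\<lambda>r. bump (n + 2) r - n * bump (n + 1) r) has_real_derivative
      ((bump (n + 4) r - (n + 2) * bump (n + 3) r) - n * (bump (n + 3) r - (n + 1) * bump (n + 2) r))) (at r)"
    for r
    using bump_has_derivative[of "n + 2" r] bump_has_derivative[of "n + 1" r]
    by (intro DERIV_diff DERIV_cmult) (simp_all add: numeral_eq_Suc)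
  from laplace_beltrami_radial[OF bump_has_derivative this, of a p w]
  show ?thesis
    by (simp add: bump_generator_def Let_def ball_bump_def[abs_def] add_ac)
qed

lemma continuous_bump_generator: "continuous_on UNIV (bump_generator n p a)"
  unfolding bump_generator_def Let_def
  by (intro continuous_intros continuous_radial_div continuous_radial_energy
      continuous_on_compose2[OF continuous_on_bump[of UNIV]]) auto

lemma radial_bounded:
  obtains D E where "D \<ge> 0" "E \<ge> 0"
    "\<And>w. norm (w - p) ^ 2 \<le> a \<Longrightarrow> \<bar>radial_div J \<alpha> p w\<bar> \<le> D"
    "\<And>w. norm (w - p) ^ 2 \<le> a \<Longrightarrow> radial_energy J \<alpha> p w \<le> E"
proof -
  have bd: "\<exists>B>0. \<forall>w. norm (w - p) ^ 2 \<le> a \<longrightarrow> \<bar>f w\<bar> \<le> B" if "continuous_on UNIV f" for f :: "real^'d \<Rightarrow> real"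
  proof -
    have "bounded (f ` cball p (sqrt a))"
      by (intro compact_imp_bounded compact_continuous_image continuous_on_subset[OF that]) auto
    then obtain B where B: "B > 0" "\<forall>y\<in>f ` cball p (sqrt a). norm y \<le> B"
      unfolding bounded_pos by blast
    have "w \<in> cball p (sqrt a)" if "norm (w - p) ^ 2 \<le> a" for w
      using that by (simp add: dist_norm norm_minus_commute real_le_rsqrt)
    with B show ?thesis by (metis image_eqI real_norm_def)
  qed
  show thesis
    using bd[OF continuous_radial_div] bd[OF continuous_radial_energy] that
    by (meson abs_le_D1 less_imp_le)
qed

text \<open>Outside the ball of squared radius \<open>a0\<close> all bumps involved vanish, and on
  it everything is bounded by compactness. The bound is uniform in \<open>a\<close> because the
  barrier moves through many values of \<open>a\<close>.\<close>

lemma bump_generator_bounded: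
  obtains C where "C \<ge> 0" "\<And>a w. a \<le> a0 \<Longrightarrow> \<bar>bump_generator n p a w\<bar> \<le> C"
proof -
  obtain D E where DE: "D \<ge> 0" "E \<ge> 0"
    "\<And>w. norm (w - p) ^ 2 \<le> a0 \<Longrightarrow> \<bar>radial_div J \<alpha> p w\<bar> \<le> D"
    "\<And>w. norm (w - p) ^ 2 \<le> a0 \<Longrightarrow> radial_energy J \<alpha> p w \<le> E"
    using radial_bounded by blast
  obtain B where B: "\<And>j r. r \<le> a0 \<Longrightarrow> \<bar>bump j r\<bar> \<le> B j"
  proof -
    have "\<exists>C. \<forall>r\<le>a0. \<bar>bump j r\<bar> \<le> C" for j using bump_bounded[of a0 j] by metis
    then show thesis using that by metis
  qed
  define Q1 where "Q1 = B (n + 2) + n * B (n + 1)"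
  define Q2 where "Q2 = B (n + 4) + (n + 2) * B (n + 3) + n * (B (n + 3) + (n + 1) * B (n + 2))"
  have B0: "B j \<ge> 0" for j using B[of a0 j] by simp
  then have Q0: "Q1 \<ge> 0" "Q2 \<ge> 0" by (auto simp: Q1_def Q2_def)
  show thesis
  proof (rule that)
    show "(Q1 * D + Q2 * E) / 2 \<ge> 0" using Q0 DE by simp
    fix a w assume a: "a \<le> a0"
    define \<rho> where "\<rho> = a - (w - p) \<bullet> (w - p)"
    show "\<bar>bump_generator n p a w\<bar> \<le> (Q1 * D + Q2 * E) / 2"
    proof (cases "\<rho> \<le> 0")
      case True
      then show ?thesis using Q0 DE(1,2)
        by (simp add: bump_generator_def \<rho>_def[symmetric] bump_def)
    next
      case False
      then have w: "norm (w - p) ^ 2 \<le> a0" using a by (simp add: \<rho>_def dot_square_norm)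
      have \<rho>: "\<rho> \<le> a0" using a inner_ge_zero[of "w - p"] unfolding \<rho>_def by linarith
      note b = B[OF \<rho>]
      have "\<bar>bump (n + 2) \<rho> - n * bump (n + 1) \<rho>\<bar> \<le> Q1"
        unfolding Q1_def by (intro abs_diff_mult_le b) simp
      moreover have "\<bar>(bump (n + 4) \<rho> - (n + 2) * bump (n + 3) \<rho>) -
          n * (bump (n + 3) \<rho> - (n + 1) * bump (n + 2) \<rho>)\<bar> \<le> Q2"
        unfolding Q2_def by (intro abs_diff_mult_le b) simp_all
      ultimately have "\<bar>bump_generator n p a w\<bar> \<le> (Q1 * \<bar>radial_div J \<alpha> p w\<bar> + Q2 * \<bar>radial_energy J \<alpha> p w\<bar>) / 2"
        unfolding bump_generator_def \<rho>_def[symmetric] Let_def abs_divide abs_numeral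
        by (intro divide_right_mono abs_add_mult_le) (simp_all add: add_ac)
      also have "\<dots> \<le> (Q1 * D + Q2 * E) / 2"
        using DE(3,4)[OF w] Q0 radial_energy_nonneg[of p w]
        by (intro divide_right_mono add_mono mult_left_mono) auto
      finally show ?thesis .
    qed
  qed
qed

text \<open>If the squared radius shrinks at speed \<open>b\<close>, the time derivative of the
  barrier is \<open>- b * ball_bump 2 p a\<close>. The conclusion is therefore the subsolution
  inequality of the moving barrier on \<open>M\<close>, up to the zeroth-order term with
  \<open>k\<close>.\<close>

lemma barrier:
  assumes "closed M" and a: "0 < a1" "a1 < a0" and "b \<ge> 0"
    and pos: "\<And>x. x \<in> M \<Longrightarrow> x \<noteq> p \<Longrightarrow> norm (x - p) ^ 2 \<le> a0 \<Longrightarrow> radial_energy J \<alpha> p x > 0"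
  obtains k where "k \<ge> 0"
    "\<And>a x. a1 \<le> a \<Longrightarrow> a \<le> a0 \<Longrightarrow> x \<in> M \<Longrightarrow>
      b * ball_bump 2 p a x - k * ball_bump 0 p a x \<le> bump_generator 0 p a x"
proof -
  obtain D E where DE: "D \<ge> 0" "E \<ge> 0"
    "\<And>w. norm (w - p) ^ 2 \<le> a0 \<Longrightarrow> \<bar>radial_div J \<alpha> p w\<bar> \<le> D"
    "\<And>w. norm (w - p) ^ 2 \<le> a0 \<Longrightarrow> radial_energy J \<alpha> p w \<le> E"
    using radial_bounded by blast
  \<comment> \<open>Points of the ball with \<open>\<rho> \<le> a1 / 2\<close> lie at squared
    distance at least \<open>a1 / 2\<close> from \<open>p\<close>. On this compact shell, which
    avoids the zero of the energy at \<open>p\<close>, the energy has a positive minimum.\<close>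
  let ?A = "M \<inter> {x. a1 / 2 \<le> norm (x - p) ^ 2} \<inter> cball p (sqrt a0)"
  have compact: "compact ?A"
    by (rule closed_Int_compact[OF closed_Int[OF \<open>closed M\<close> closed_Collect_le] compact_cball])
      (intro continuous_intros)+
  have cb: "x \<in> cball p (sqrt a0) \<longleftrightarrow> norm (x - p) ^ 2 \<le> a0" for x
  proof -
    have "norm (x - p) \<le> sqrt a0 \<longleftrightarrow> norm (x - p) ^ 2 \<le> a0"
      using real_sqrt_le_iff[of "norm (x - p) ^ 2" a0] by simp
    then show ?thesis by (metis dist_commute dist_norm mem_cball)
  qed
  obtain c0 where c0: "c0 > 0" "\<And>x. x \<in> ?A \<Longrightarrow> radial_energy J \<alpha> p x \<ge> c0"
  proof (cases "?A = {}")
    case True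
    show ?thesis
    proof (rule that[of 1])
      show "1 \<le> radial_energy J \<alpha> p x" if "x \<in> ?A" for x
        using that unfolding True by simp
    qed simp
  next
    case False
    from continuous_attains_inf[OF compact False
        continuous_on_subset[OF continuous_radial_energy subset_UNIV], of p]
    obtain x where x: "x \<in> ?A" "\<And>y. y \<in> ?A \<Longrightarrow> radial_energy J \<alpha> p x \<le> radial_energy J \<alpha> p y"
      by metis
    have "x \<in> M" "x \<noteq> p" "norm (x - p) ^ 2 \<le> a0" using x(1) a cb[of x] by auto
    from that[OF pos[OF this] x(2)] show ?thesis .
  qed
  obtain k where k: "k \<ge> 0"
    "\<And>\<rho> \<Lambda> \<Gamma>. 0 < \<rho> \<Longrightarrow> \<rho> \<le> a0 \<Longrightarrow> \<bar>\<Lambda>\<bar> \<le> D \<Longrightarrow> 0 \<le> \<Gamma> \<Longrightarrow> \<Gamma> \<le> E \<Longrightarrow> (\<rho> \<le> a1 / 2 \<Longrightarrow> c0 \<le> \<Gamma>) \<Longrightarrow>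
      0 \<le> \<rho>\<^sup>2 * \<Lambda> / 2 + (1 - 2 * \<rho>) * \<Gamma> / 2 - b * \<rho>\<^sup>2 + k * \<rho> ^ 4"
    by (rule barrier_poly[OF \<open>b \<ge> 0\<close> DE(1,2) c0(1) half_gt_zero[OF a(1)] order.strict_trans[OF a]]) blast
  show thesis
  proof (rule that[OF k(1)])
    fix a x assume *: "a1 \<le> a" "a \<le> a0" "x \<in> M"
    define \<rho> where "\<rho> = a - (x - p) \<bullet> (x - p)"
    show "b * ball_bump 2 p a x - k * ball_bump 0 p a x \<le> bump_generator 0 p a x"
    proof (cases "\<rho> \<le> 0")
      case True
      then show ?thesis
        by (simp add: bump_generator_def ball_bump_def \<rho>_def[symmetric] bump_def)
    next
      case False
      have n: "norm (x - p) ^ 2 = a - \<rho>" by (simp add: \<rho>_def dot_square_norm)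
      with False * zero_le_power2[of "norm (x - p)"]
      have \<rho>: "0 < \<rho>" "\<rho> \<le> a0" and x: "norm (x - p) ^ 2 = a - \<rho>" "norm (x - p) ^ 2 \<le> a0"
        by linarith+
      let ?\<Lambda> = "radial_div J \<alpha> p x" and ?\<Gamma> = "radial_energy J \<alpha> p x"
      \<comment> \<open>With this common factor taken out, the bumps become powers of
        \<open>\<rho>\<close> and the claim becomes polynomial.\<close>
      define h where "h = exp (- inverse \<rho>) / \<rho> ^ 4"
      have h: "h \<ge> 0" using \<rho> by (simp add: h_def)
      have bumps: "bump 0 \<rho> = h * \<rho> ^ 4" "bump 2 \<rho> = h * \<rho>\<^sup>2" "bump 3 \<rho> = h * \<rho>" "bump 4 \<rho> = h"
        using \<rho> by (simp_all add: bump_def h_def power_numeral_reduce)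
      have "0 \<le> \<rho>\<^sup>2 * ?\<Lambda> / 2 + (1 - 2 * \<rho>) * ?\<Gamma> / 2 - b * \<rho>\<^sup>2 + k * \<rho> ^ 4"
      proof (rule k(2)[OF \<rho> DE(3)[OF x(2)] radial_energy_nonneg DE(4)[OF x(2)]])
        assume "\<rho> \<le> a1 / 2"
        moreover have "x \<in> cball p (sqrt a0)" using x(2) cb by blast
        ultimately have "x \<in> ?A" using x(1) * by simp
        then show "c0 \<le> ?\<Gamma>" by (rule c0(2))
      qed
      then have "0 \<le> h * (\<rho>\<^sup>2 * ?\<Lambda> / 2 + (1 - 2 * \<rho>) * ?\<Gamma> / 2 - b * \<rho>\<^sup>2 + k * \<rho> ^ 4)"
        using h by simp
      also have "\<dots> = ((h * \<rho>\<^sup>2) * ?\<Lambda> + (h - 2 * (h * \<rho>)) * ?\<Gamma>) / 2 - (b * (h * \<rho>\<^sup>2) - k * (h * \<rho> ^ 4))"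
        by (simp add: field_simps)
      also have "((h * \<rho>\<^sup>2) * ?\<Lambda> + (h - 2 * (h * \<rho>)) * ?\<Gamma>) / 2 = bump_generator 0 p a x"
        by (simp add: bump_generator_def \<rho>_def[symmetric] Let_def bumps flip: numeral_2_eq_2)
      finally show ?thesis
        by (simp add: ball_bump_def \<rho>_def[symmetric] bumps)
    qed
  qed
qed

end

locale leaf_diffusion =
  full_rank_field J \<alpha> + brownian_motion M "\<lambda>w. {v. J w *v v = 0}" \<alpha> w0 \<Omega> F X \<zeta>
  for J :: "real^'d \<Rightarrow> real^'d^'m" and \<alpha> :: real and M :: "(real^'d) set" and w0
    and \<Omega> :: "'p measure" and F X \<zeta>
begin

text \<open>The barrier argument in discrete time: over each short step the process first runs with
  the ball fixed, then the ball shrinks. Losses per step are a factor close to 1 and an error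
  quadratic in the step length, as \<open>discrete_growth\<close> requires.\<close>

lemma spread:
  assumes "closed M" and a: "0 < a1" "a1 < a0" and s: "0 \<le> s0" "s0 < s1"
    and pos: "\<And>x. x \<in> M \<Longrightarrow> x \<noteq> p \<Longrightarrow> norm (x - p) ^ 2 \<le> a0 \<Longrightarrow> radial_energy J \<alpha> p x > 0"
    and start: "mean (ball_bump 0 p a0) s0 > 0"
  shows "mean (ball_bump 0 p a1) s1 > 0"
proof -
  define \<tau> where "\<tau> = s1 - s0"
  \<comment> \<open>The speed at which the squared radius falls from \<open>a0\<close> to
    \<open>a1\<close> during the time \<open>\<tau>\<close>.\<close>
  define b where "b = (a0 - a1) / \<tau>"
  have \<tau>: "\<tau> > 0" and b: "b \<ge> 0" "a0 - b * \<tau> = a1" using a s by (auto simp: \<tau>_def b_def)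
  obtain k where k: "k \<ge> 0" "\<And>a x. a1 \<le> a \<Longrightarrow> a \<le> a0 \<Longrightarrow> x \<in> M \<Longrightarrow>
      b * ball_bump 2 p a x - k * ball_bump 0 p a x \<le> bump_generator 0 p a x"
    using barrier[OF \<open>closed M\<close> a b(1) pos] by metis
  obtain C0 C2 where C0: "C0 \<ge> 0" "\<And>a w. a \<le> a0 \<Longrightarrow> \<bar>bump_generator 0 p a w\<bar> \<le> C0"
    and C2: "C2 \<ge> 0" "\<And>a w. a \<le> a0 \<Longrightarrow> \<bar>bump_generator 2 p a w\<bar> \<le> C2"
    using bump_generator_bounded[of a0 _ p] by metis
  obtain Ct where Ct: "Ct \<ge> 0"
    "\<And>r d. r \<le> a0 \<Longrightarrow> d \<ge> 0 \<Longrightarrow> bump 0 (r - d) \<ge> bump 0 r - d * bump 2 r - Ct * d\<^sup>2"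
    using bump_taylor[of a0] by metis
  define G where "G a s = mean (ball_bump 0 p a) s" for a s
  define H where "H a s = mean (ball_bump 2 p a) s" for a s
  \<comment> \<open>The three quadratic errors: Taylor expansion in the squared radius, variation of
    \<open>H\<close> during the step, and variation of \<open>G\<close> during the step.\<close>
  define K where "K = Ct * b\<^sup>2 + b * C2 + k * C0"
  have K: "K \<ge> 0" using Ct b C2 k C0 by (simp add: K_def)
  have cont: "continuous_on UNIV (ball_bump n p a)" for n a
    by (rule test_function_continuous[OF test_function_ball_bump])
  obtain B where B: "\<And>n a x. \<bar>ball_bump n p a x\<bar> \<le> B n a"
  proof -
    have "\<exists>C. \<forall>x. \<bar>ball_bump n p a x\<bar> \<le> C" for n a
      using test_function_bounded[OF test_function_ball_bump[of n p a]] by metis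
    then show thesis using that by metis
  qed
  have step: "(1 - k * \<delta>) * G a s - K * \<delta>\<^sup>2 \<le> G (a - b * \<delta>) (s + \<delta>)"
    if "s \<ge> 0" "\<delta> \<ge> 0" "a \<le> a0" "a1 \<le> a" for s \<delta> a
  proof -
    note inc0 = mean_increment[OF test_function_ball_bump half_laplace_ball_bump[of 0 p a]
        continuous_bump_generator C0(2)[OF \<open>a \<le> a0\<close>]]
    note inc2 = mean_increment[OF test_function_ball_bump half_laplace_ball_bump[of 2 p a]
        continuous_bump_generator C2(2)[OF \<open>a \<le> a0\<close>]]
    have gen0: "\<bar>mean (bump_generator 0 p a) r\<bar> \<le> C0" if "r \<ge> 0" for r
      by (rule mean_bound[OF continuous_bump_generator that C0(2)[OF \<open>a \<le> a0\<close>] C0(1)])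
    have gen2: "\<bar>mean (bump_generator 2 p a) r\<bar> \<le> C2" if "r \<ge> 0" for r
      by (rule mean_bound[OF continuous_bump_generator that C2(2)[OF \<open>a \<le> a0\<close>] C2(1)])
    \<comment> \<open>The barrier inequality with \<open>G\<close> frozen at the start of the step
      and \<open>H\<close> at its end. The end is chosen for \<open>H\<close> so that it cancels
      against the first-order loss from shrinking the ball there.\<close>
    have "b * H a (s + \<delta>) - b * C2 * \<delta> - k * G a s - k * C0 * \<delta> \<le> mean (bump_generator 0 p a) r"
      if r: "s \<le> r" "r \<le> s + \<delta>" for r
    proof -
      have "r \<ge> 0" using r \<open>s \<ge> 0\<close> by simp
      have "H a (s + \<delta>) - H a r \<le> C2 * (s + \<delta> - r)"
        unfolding H_def by (rule inc2(2)[OF \<open>r \<ge> 0\<close> r(2)]) (rule abs_le_D1[OF gen2], use \<open>r \<ge> 0\<close> in simp)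
      also have "\<dots> \<le> C2 * \<delta>" using r C2 by (intro mult_left_mono) auto
      finally have H: "b * (H a (s + \<delta>) - C2 * \<delta>) \<le> b * H a r"
        using b by (intro mult_left_mono) auto
      have "G a r - G a s \<le> C0 * (r - s)"
        unfolding G_def by (rule inc0(2)[OF \<open>s \<ge> 0\<close> r(1)]) (rule abs_le_D1[OF gen0], use \<open>s \<ge> 0\<close> in simp)
      also have "\<dots> \<le> C0 * \<delta>" using r C0 by (intro mult_left_mono) auto
      finally have G: "k * G a r \<le> k * (G a s + C0 * \<delta>)"
        using k by (intro mult_left_mono) auto
      have bB: "\<bar>b * ball_bump 2 p a x\<bar> \<le> b * B 2 a" for x
        using b mult_left_mono[OF B[of 2 a x], of b] by (simp add: abs_mult)
      have cb: "continuous_on UNIV (\<lambda>x. b * ball_bump 2 p a x)"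
        by (intro continuous_on_mult continuous_on_const cont)
      have "alive (\<lambda>x. b * ball_bump 2 p a x) r = (\<lambda>\<omega>. b * alive (ball_bump 2 p a) r \<omega>)"
        by (auto simp: alive_def)
      then have "mean (\<lambda>x. b * ball_bump 2 p a x) r = b * H a r"
        by (simp add: H_def mean_def)
      then have "b * H a r - k * G a r = mean (\<lambda>x. b * ball_bump 2 p a x + (- k) * ball_bump 0 p a x) r"
        using mean_add_cmult[OF cb cont \<open>r \<ge> 0\<close> bB B, where c = "- k"] by (simp add: G_def)
      also have "\<dots> \<le> mean (bump_generator 0 p a) r"
      proof (rule mean_mono)
        show "\<bar>b * ball_bump 2 p a x + (- k) * ball_bump 0 p a x\<bar> \<le> b * B 2 a + k * B 0 a" for x
          using abs_diff_mult_le[OF bB B k(1)] by simp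
        show "b * ball_bump 2 p a x + (- k) * ball_bump 0 p a x \<le> bump_generator 0 p a x" if "x \<in> M" for x
          using k(2)[OF \<open>a1 \<le> a\<close> \<open>a \<le> a0\<close> that] by simp
        show "continuous_on UNIV (\<lambda>x. b * ball_bump 2 p a x + (- k) * ball_bump 0 p a x)"
          by (intro continuous_on_add continuous_on_mult continuous_on_const cont)
      qed (rule continuous_bump_generator \<open>r \<ge> 0\<close> C0(2)[OF \<open>a \<le> a0\<close>])+
      finally have "b * H a r - k * G a r \<le> mean (bump_generator 0 p a) r" .
      moreover have "b * (H a (s + \<delta>) - C2 * \<delta>) = b * H a (s + \<delta>) - b * C2 * \<delta>"
        "k * (G a s + C0 * \<delta>) = k * G a s + k * C0 * \<delta>"
        by (simp_all add: right_diff_distrib distrib_left)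
      ultimately show ?thesis using H G by linarith
    qed
    moreover have "s \<le> s + \<delta>" using \<open>\<delta> \<ge> 0\<close> by simp
    ultimately have "(b * H a (s + \<delta>) - b * C2 * \<delta> - k * G a s - k * C0 * \<delta>) * (s + \<delta> - s)
        \<le> mean (ball_bump 0 p a) (s + \<delta>) - mean (ball_bump 0 p a) s"
      by (intro inc0(1) \<open>s \<ge> 0\<close>)
    then have 1: "(b * H a (s + \<delta>) - b * C2 * \<delta> - k * G a s - k * C0 * \<delta>) * \<delta> \<le> G a (s + \<delta>) - G a s"
      by (simp add: G_def)
    have b\<delta>: "0 \<le> b * \<delta>" using b \<open>\<delta> \<ge> 0\<close> by simp
    \<comment> \<open>Second half of the step: the ball shrinks at the fixed time
      \<open>s + \<delta>\<close>, estimated by \<open>bump_taylor\<close>.\<close>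
    have "G a (s + \<delta>) - b * \<delta> * H a (s + \<delta>) =
        mean (\<lambda>x. ball_bump 0 p a x + (- (b * \<delta>)) * ball_bump 2 p a x) (s + \<delta>)"
      using mean_add_cmult[OF cont cont _ B B, of "s + \<delta>" 0 a "- (b * \<delta>)" 2 a] that by (simp add: G_def H_def)
    also have "\<dots> \<le> mean (\<lambda>x. ball_bump 0 p (a - b * \<delta>) x + (Ct * (b * \<delta>)\<^sup>2) * 1) (s + \<delta>)"
    proof (rule mean_mono)
      show "\<bar>ball_bump 0 p a x + (- (b * \<delta>)) * ball_bump 2 p a x\<bar> \<le> B 0 a + (b * \<delta>) * B 2 a" for x
        using abs_diff_mult_le[OF B B b\<delta>] by simp
      show "\<bar>ball_bump 0 p (a - b * \<delta>) x + (Ct * (b * \<delta>)\<^sup>2) * 1\<bar> \<le> B 0 (a - b * \<delta>) + Ct * (b * \<delta>)\<^sup>2" for x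
        using abs_triangle_ineq[of "ball_bump 0 p (a - b * \<delta>) x" "Ct * (b * \<delta>)\<^sup>2"]
          B[of 0 "a - b * \<delta>" x] Ct(1) by simp
      show "ball_bump 0 p a x + (- (b * \<delta>)) * ball_bump 2 p a x
          \<le> ball_bump 0 p (a - b * \<delta>) x + (Ct * (b * \<delta>)\<^sup>2) * 1" for x
      proof -
        define q where "q = (x - p) \<bullet> (x - p)"
        have "a - q \<le> a0" using \<open>a \<le> a0\<close> inner_ge_zero[of "x - p"] unfolding q_def by linarith
        then have ineq: "bump 0 (a - q) - b * \<delta> * bump 2 (a - q) - Ct * (b * \<delta>)\<^sup>2 \<le> bump 0 (a - q - b * \<delta>)"
          by (rule Ct(2)[OF _ b\<delta>])
        have shift: "u + - t * v \<le> u' + c * 1" if "u - t * v - c \<le> u'" for u t v u' c :: real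
          using that by simp
        have eq: "a - b * \<delta> - q = a - q - b * \<delta>" by simp
        show ?thesis
          unfolding ball_bump_def q_def[symmetric] eq using ineq by (rule shift)
      qed
      show "0 \<le> s + \<delta>" using that by simp
    qed (intro continuous_on_add continuous_on_mult continuous_on_const cont)+
    also have "\<dots> = G (a - b * \<delta>) (s + \<delta>) + (Ct * (b * \<delta>)\<^sup>2) * mean (\<lambda>_. 1) (s + \<delta>)"
      unfolding G_def using that by (intro mean_add_cmult[OF cont continuous_on_const _ B, where D = 1]) auto
    \<comment> \<open>The mean of the constant 1 is the probability of still being alive, hence at
      most 1.\<close>
    also have "\<dots> \<le> G (a - b * \<delta>) (s + \<delta>) + (Ct * (b * \<delta>)\<^sup>2) * 1"
      using Ct that mean_bound[of "\<lambda>_. 1" "s + \<delta>" 1] by (intro add_mono mult_left_mono) auto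
    finally have 2: "G a (s + \<delta>) - b * \<delta> * H a (s + \<delta>) \<le> G (a - b * \<delta>) (s + \<delta>) + Ct * (b * \<delta>)\<^sup>2"
      by simp
    have "K * \<delta>\<^sup>2 = Ct * (b * \<delta>)\<^sup>2 + b * C2 * \<delta>\<^sup>2 + k * C0 * \<delta>\<^sup>2"
      by (simp add: K_def distrib_right power_mult_distrib)
    moreover have "(b * H a (s + \<delta>) - b * C2 * \<delta> - k * G a s - k * C0 * \<delta>) * \<delta> =
        b * \<delta> * H a (s + \<delta>) - b * C2 * \<delta>\<^sup>2 - k * \<delta> * G a s - k * C0 * \<delta>\<^sup>2"
      by (simp add: left_diff_distrib power2_eq_square)
    moreover have "(1 - k * \<delta>) * G a s = G a s - k * \<delta> * G a s" by (simp add: left_diff_distrib)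
    ultimately show ?thesis using 1 2 by linarith
  qed
  show ?thesis
  proof (rule discrete_growth[OF k(1) K \<tau> start,
        where u = "\<lambda>n i. G (a0 - b * (real i * (\<tau> / real n))) (s0 + real i * (\<tau> / real n))"])
    show "(1 - k * (\<tau> / n)) * G (a0 - b * (real i * (\<tau> / n))) (s0 + real i * (\<tau> / n)) - K * (\<tau> / n)\<^sup>2
        \<le> G (a0 - b * (real (Suc i) * (\<tau> / n))) (s0 + real (Suc i) * (\<tau> / n))" if "i < n" for i n :: nat
    proof -
      have "real i * (\<tau> / n) \<le> \<tau>" using that \<tau> by (simp add: field_simps)
      then have "b * (real i * (\<tau> / n)) \<le> b * \<tau>" using b by (intro mult_left_mono)
      then have "a1 \<le> a0 - b * (real i * (\<tau> / n))" using b by linarith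
      moreover have "real (Suc i) * (\<tau> / n) = real i * (\<tau> / n) + \<tau> / n"
        by (simp add: distrib_right add_divide_distrib)
      moreover have "a0 - b * (x + y) = a0 - b * x - b * y" "s0 + (x + y) = s0 + x + y" for x y
        by (auto simp: distrib_left)
      moreover have "a0 - b * (real i * (\<tau> / n)) \<le> a0" "0 \<le> s0 + real i * (\<tau> / n)" "0 \<le> \<tau> / n"
        using b \<tau> s by auto
      ultimately show ?thesis
        using step[of "s0 + real i * (\<tau> / n)" "\<tau> / n" "a0 - b * (real i * (\<tau> / n))"] by (simp only:)
    qed
  qed (use b in \<open>auto simp: G_def \<tau>_def\<close>)
qed

end

section \<open>Spreading of mass along a leaf\<close>

lemma ball_bump_pos_iff: "ball_bump n p a x > 0 \<longleftrightarrow> norm (x - p) ^ 2 < a"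
  by (simp add: ball_bump_def bump_pos_iff dot_square_norm)

lemma ball_bump_nonneg: "ball_bump n p a x \<ge> 0"
  by (simp add: ball_bump_def bump_nonneg)

lemma smooth_map_jacobian_entry:
  assumes "smooth_map \<Phi>"
  shows "smooth_map (\<lambda>w. jacobian \<Phi> (at w) $ i $ j)"
  unfolding jacobian_def matrix_def
  by (simp, intro smooth_map_vec_nth smooth_map_frechet_derivative assms)

section \<open>A uniform radius of positive radial energy on compact sets\<close>

context full_rank_field
begin

lemma right_inv_bounded:
  assumes "compact S"
  obtains C where "C > 0" "\<And>w v. w \<in> S \<Longrightarrow> norm (right_inv (J w) *v v) \<le> C * norm v"
proof -
  let ?s = "\<lambda>w. \<Sum>i\<in>UNIV. \<Sum>j\<in>UNIV. \<bar>right_inv (J w) $ i $ j\<bar>"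
  have "continuous_on S ?s"
    by (intro continuous_intros smooth_map_continuous_on smooth_map_right_inv smooth_J rank_J)
  then have "bounded (?s ` S)"
    using assms by (intro compact_imp_bounded compact_continuous_image)
  then obtain C where C: "C > 0" "\<And>w. w \<in> S \<Longrightarrow> norm (?s w) \<le> C"
    unfolding bounded_pos by blast
  have "norm (right_inv (J w) *v v) \<le> C * norm v" if "w \<in> S" for w v
  proof -
    have "norm (right_inv (J w) *v v) \<le> onorm ((*v) (right_inv (J w))) * norm v"
      by (rule onorm) (rule matrix_vector_mul_bounded_linear)
    also have "\<dots> \<le> ?s w * norm v"
      by (intro mult_right_mono onorm_le_matrix_component_sum) simp
    also have "\<dots> \<le> C * norm v"
      using C(2)[OF that] by (intro mult_right_mono) auto
    finally show ?thesis .
  qed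
  with C(1) show thesis by (rule that)
qed

lemma J_uniformly_continuous:
  assumes "compact S" "\<epsilon> > 0"
  obtains \<delta> where "\<delta> > 0" "\<And>w x. w \<in> S \<Longrightarrow> x \<in> S \<Longrightarrow> dist w x < \<delta> \<Longrightarrow> onorm ((*v) (J w - J x)) \<le> \<epsilon>"
proof -
  let ?s = "\<lambda>q. \<Sum>i\<in>UNIV. \<Sum>j\<in>UNIV. \<bar>J (fst q) $ i $ j - J (snd q) $ i $ j\<bar>"
  have J: "continuous_on UNIV (\<lambda>w. J w $ i $ j)" for i j
    by (intro smooth_map_continuous_on smooth_J)
  have "continuous_on (S \<times> S) (\<lambda>q. J (fst q) $ i $ j)" "continuous_on (S \<times> S) (\<lambda>q. J (snd q) $ i $ j)" for i j
    by (rule continuous_on_compose2[OF J continuous_on_fst[OF continuous_on_id]], simp)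
      (rule continuous_on_compose2[OF J continuous_on_snd[OF continuous_on_id]], simp)
  then have "continuous_on (S \<times> S) ?s"
    by (intro continuous_on_sum continuous_on_rabs continuous_on_diff)
  \<comment> \<open>Uniform continuity in the pair is used only against diagonal points, where the
    sum of entry differences is 0.\<close>
  then have "uniformly_continuous_on (S \<times> S) ?s"
    using assms(1) by (intro compact_uniformly_continuous compact_Times)
  then obtain \<delta> where \<delta>: "\<delta> > 0"
    "\<And>q q'. q \<in> S \<times> S \<Longrightarrow> q' \<in> S \<times> S \<Longrightarrow> dist q' q < \<delta> \<Longrightarrow> dist (?s q') (?s q) < \<epsilon>"
    by (rule uniformly_continuous_onE[OF _ assms(2)]) blast
  have "onorm ((*v) (J w - J x)) \<le> \<epsilon>" if "w \<in> S" "x \<in> S" "dist w x < \<delta>" for w x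
  proof -
    have "onorm ((*v) (J w - J x)) \<le> ?s (w, x)"
      using onorm_le_matrix_component_sum[of "J w - J x"] by simp
    also have "\<dots> \<le> \<epsilon>"
      using \<delta>(2)[of "(x, x)" "(w, x)"] that by (simp add: dist_Pair_Pair dist_real_def)
    finally show ?thesis .
  qed
  with \<delta>(1) show thesis by (rule that)
qed

text \<open>If \<open>x - p\<close> had no component along the leaf through \<open>x\<close>, then \<open>x - p = J\<^sup>+ (J (x - p))\<close>, whereas
  \<open>J (x - p)\<close> is of smaller order than \<open>x - p\<close> when \<open>\<Phi> x = \<Phi> p\<close>.\<close>

lemma uniform_radius:
  assumes \<Phi>: "\<And>w. (\<Phi> has_derivative (*v) (J w)) (at w)" and "compact K"
  obtains R where "R > 0"
    "\<And>p x. p \<in> K \<Longrightarrow> \<Phi> x = \<Phi> p \<Longrightarrow> x \<noteq> p \<Longrightarrow> norm (x - p) < R \<Longrightarrow> radial_energy J \<alpha> p x > 0"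
proof -
  obtain B where B: "\<And>x. x \<in> K \<Longrightarrow> norm x \<le> B"
    using compact_imp_bounded[OF \<open>compact K\<close>] unfolding bounded_iff by blast
  \<comment> \<open>The extra 1 leaves room for the points within distance 1 of
    \<open>K\<close>.\<close>
  define S where "S = cball (0::real^'d) (B + 1)"
  have S: "compact S" by (simp add: S_def)
  obtain C where C: "C > 0" "\<And>w v. w \<in> S \<Longrightarrow> norm (right_inv (J w) *v v) \<le> C * norm v"
    using right_inv_bounded[OF S] by blast
  \<comment> \<open>The tolerance is chosen so that the linearization error, after applying the
    right inverse, is at most half of \<open>norm (x - p)\<close>.\<close>
  obtain \<delta> where \<delta>: "\<delta> > 0"
    "\<And>w x. w \<in> S \<Longrightarrow> x \<in> S \<Longrightarrow> dist w x < \<delta> \<Longrightarrow> onorm ((*v) (J w - J x)) \<le> 1 / (2 * C)"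
    using J_uniformly_continuous[OF S, of "1 / (2 * C)"] C(1) by auto
  show thesis
  proof (rule that[of "min 1 \<delta>"])
    fix p x assume p: "p \<in> K" and eq: "\<Phi> x = \<Phi> p" and ne: "x \<noteq> p" and near: "norm (x - p) < min 1 \<delta>"
    have "norm x \<le> norm p + norm (x - p)" using norm_triangle_ineq[of p "x - p"] by simp
    then have S: "x \<in> S" "p \<in> S" using B[OF p] near by (auto simp: S_def)
    let ?S = "S \<inter> ball x \<delta>"
    have mem: "x \<in> ?S" "p \<in> ?S" using S near \<delta>(1) by (auto simp: dist_norm)
    have "convex ?S" by (simp add: S_def convex_Int)
    then have "closed_segment x p \<subseteq> ?S" using mem by (simp add: convex_contains_segment)
    moreover have "x + t *\<^sub>R (p - x) \<in> closed_segment x p" if "t \<in> {0..1}" for t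
      using that by (auto simp: in_segment algebra_simps intro!: exI[of _ t])
    ultimately have seg: "x + t *\<^sub>R (p - x) \<in> ?S" if "t \<in> {0..1}" for t
      using that by blast
    have on: "onorm ((*v) (J w) - (*v) (J x)) \<le> 1 / (2 * C)" if "w \<in> ?S" for w
    proof -
      have "(*v) (J w) - (*v) (J x) = (*v) (J w - J x)"
        by (auto simp: matrix_vector_mult_diff_rdistrib)
      then show ?thesis using \<delta>(2)[of w x] that S by (simp add: dist_commute)
    qed
    have "norm (\<Phi> p - \<Phi> x - J x *v (p - x)) \<le> norm (p - x) * (1 / (2 * C))"
      by (rule differentiable_bound_linearization[OF seg has_derivative_at_withinI[OF \<Phi>] on mem(1)])
    then have J: "norm (J x *v (x - p)) \<le> norm (x - p) / (2 * C)"
      using eq by (simp add: matrix_vector_mult_diff_distrib norm_minus_commute)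
    have "radial_field J \<alpha> p x \<noteq> 0"
    proof
      assume "radial_field J \<alpha> p x = 0"
      then have "x - p = right_inv (J x) *v (J x *v (x - p))"
        using \<alpha>_pos by (simp add: radial_field_def kernel_proj_apply)
      then have "norm (x - p) \<le> C * norm (J x *v (x - p))"
        using C(2)[OF S(1)] by metis
      also have "\<dots> \<le> C * (norm (x - p) / (2 * C))"
        using J C(1) by (intro mult_left_mono) auto
      also have "\<dots> = norm (x - p) / 2" using C(1) by simp
      finally show False using ne by simp
    qed
    then show "radial_energy J \<alpha> p x > 0"
      using \<alpha>_pos by (simp add: radial_energy_def)
  qed (use \<delta>(1) in simp)
qed

end

section \<open>Charged points and their propagation\<close>

context leaf_diffusion
begin

text \<open>Only the sets of positivity matter: if the mean of \<open>\<psi>\<close> were 0, then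
  \<open>\<psi>\<close> would vanish almost surely along the living process, and
  \<open>\<phi>\<close> would be almost surely at most 0.\<close>

lemma mean_pos_mono:
  assumes cont: "continuous_on UNIV \<phi>" "continuous_on UNIV \<psi>" and "s \<ge> 0"
    and bound: "\<And>x. \<bar>\<phi> x\<bar> \<le> C" "\<And>x. \<bar>\<psi> x\<bar> \<le> D" and nonneg: "\<And>x. \<psi> x \<ge> 0"
    and "\<And>x. \<phi> x > 0 \<Longrightarrow> \<psi> x > 0" and pos: "mean \<phi> s > 0"
  shows "mean \<psi> s > 0"
proof (rule ccontr)
  assume "\<not> mean \<psi> s > 0"
  moreover have al: "alive \<psi> s \<omega> \<ge> 0" for \<omega> using nonneg by (simp add: alive_def)
  moreover have "expectation (alive \<psi> s) \<ge> 0"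
    by (rule Bochner_Integration.integral_nonneg) (rule al)
  ultimately have "expectation (alive \<psi> s) = 0"
    unfolding mean_def by linarith
  then have "AE \<omega> in \<Omega>. alive \<psi> s \<omega> = 0"
    using integral_nonneg_eq_0_iff_AE[OF integrable_alive[OF cont(2) \<open>s \<ge> 0\<close> bound(2)]] al by simp
  then have "AE \<omega> in \<Omega>. alive \<phi> s \<omega> \<le> 0"
  proof eventually_elim
    case (elim \<omega>)
    then show ?case using assms(7)[of "X s \<omega>"] by (cases "\<phi> (X s \<omega>) > 0") (auto simp: alive_def)
  qed
  then have "expectation (alive \<phi> s) \<le> expectation (\<lambda>_. 0)"
    by (intro integral_mono_AE integrable_alive[OF cont(1) \<open>s \<ge> 0\<close> bound(1)]) auto
  then show False using pos by (simp add: mean_def)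
qed

lemma mean_ball_bump_pos_mono:
  assumes "s \<ge> 0" "\<And>x. norm (x - p) ^ 2 < a \<Longrightarrow> norm (x - q) ^ 2 < b" "mean (ball_bump 0 p a) s > 0"
  shows "mean (ball_bump 0 q b) s > 0"
proof -
  obtain C where C: "\<And>x. \<bar>ball_bump 0 p a x\<bar> \<le> C"
    using test_function_bounded[OF test_function_ball_bump[of 0 p a]] by metis
  obtain D where D: "\<And>x. \<bar>ball_bump 0 q b x\<bar> \<le> D"
    using test_function_bounded[OF test_function_ball_bump[of 0 q b]] by metis
  show ?thesis
    by (rule mean_pos_mono[OF test_function_continuous test_function_continuous \<open>s \<ge> 0\<close> C D
          ball_bump_nonneg _ assms(3)])
      (auto simp: ball_bump_pos_iff assms(2) test_function_ball_bump)
qed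

text \<open>Membership of \<open>p\<close> in the support of the law of the living process, tested
  with bumps so that the results on \<open>mean\<close> apply directly.\<close>

definition charged :: "real \<Rightarrow> real^'d \<Rightarrow> bool" where
  "charged s p \<longleftrightarrow> (\<forall>a>0. mean (ball_bump 0 p a) s > 0)"

lemma charged_start: "charged 0 w0"
proof -
  have "mean (ball_bump 0 w0 a) 0 = ball_bump 0 w0 a w0" for a
  proof -
    have "mean (ball_bump 0 w0 a) 0 = expectation (\<lambda>_. ball_bump 0 w0 a w0)"
      unfolding mean_def
    proof (rule Bochner_Integration.integral_cong[OF refl])
      show "alive (ball_bump 0 w0 a) 0 \<omega> = ball_bump 0 w0 a w0" if "\<omega> \<in> space \<Omega>" for \<omega>
        using path(1,2)[OF that] by (simp add: alive_def flip: zero_ereal_def)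
    qed
    then show ?thesis by (simp add: prob_space)
  qed
  then show ?thesis by (simp add: charged_def ball_bump_pos_iff)
qed

text \<open>A small ball around \<open>y\<close> fits inside the ball of radius \<open>r\<close>
  around \<open>p\<close>, which therefore carries mass at time \<open>s0\<close>;
  \<open>spread\<close> then concentrates it around \<open>p\<close> by time
  \<open>s1\<close>.\<close>

lemma charged_spread:
  assumes "closed M" "0 \<le> s0" "s0 < s1" "charged s0 y" "norm (y - p) < R"
    and pos: "\<And>x. x \<in> M \<Longrightarrow> x \<noteq> p \<Longrightarrow> norm (x - p) < R \<Longrightarrow> radial_energy J \<alpha> p x > 0"
  shows "charged s1 p"
  unfolding charged_def
proof (intro allI impI)
  fix a :: real assume "a > 0"
  obtain r where r: "norm (y - p) < r" "r < R" using dense[OF assms(5)] by blast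
  have r0: "r > 0" using r(1) norm_ge_zero[of "y - p"] by linarith
  \<comment> \<open>Halving guarantees the strict decrease that \<open>spread\<close> demands, even
    when \<open>a\<close> is large.\<close>
  define a1 where "a1 = min a (r\<^sup>2 / 2)"
  have a1: "0 < a1" "a1 \<le> a" "a1 < r\<^sup>2" using \<open>a > 0\<close> r0 by (auto simp: a1_def min_less_iff_disj)
  have st: "mean (ball_bump 0 p (r\<^sup>2)) s0 > 0"
  proof (rule mean_ball_bump_pos_mono[OF \<open>0 \<le> s0\<close>])
    show "mean (ball_bump 0 y ((r - norm (y - p))\<^sup>2)) s0 > 0"
      using \<open>charged s0 y\<close> r by (simp add: charged_def)
    fix x assume "norm (x - y) ^ 2 < (r - norm (y - p))\<^sup>2"
    then have "norm (x - y) < r - norm (y - p)"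
      by (rule power2_less_imp_less) (use r(1) in simp)
    then have "norm (x - p) < r" using norm_triangle_ineq[of "x - y" "y - p"] by simp
    then show "norm (x - p) ^ 2 < r\<^sup>2" by (rule power_strict_mono) auto
  qed
  have pos': "radial_energy J \<alpha> p x > 0" if "x \<in> M" "x \<noteq> p" "norm (x - p) ^ 2 \<le> r\<^sup>2" for x
  proof -
    have "norm (x - p) \<le> r" by (rule power2_le_imp_le[OF that(3)]) (use r0 in simp)
    then have "norm (x - p) < R" using r(2) by linarith
    with that(1,2) show ?thesis by (rule pos)
  qed
  have "mean (ball_bump 0 p a1) s1 > 0"
    by (rule spread[OF \<open>closed M\<close> a1(1,3) assms(2,3) pos' st])
  then show "mean (ball_bump 0 p a) s1 > 0"
    by (rule mean_ball_bump_pos_mono[rotated 2]) (use a1(2) assms(2,3) in linarith)+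
qed

text \<open>One radius \<open>R\<close> works for all of \<open>K\<close>: charge jumps between any
  two points of \<open>K\<close> closer than \<open>R\<close>. The charged points thus form a set
  that is both open and closed in \<open>K\<close>.\<close>

lemma charged_connected:
  assumes \<Phi>: "\<And>w. (\<Phi> has_derivative (*v) (J w)) (at w)" and M: "M = {w. \<Phi> w = \<Phi> w0}"
    and K: "compact K" "connected K" "w0 \<in> K" "K \<subseteq> M" and "p \<in> K" "s > 0"
  shows "charged s p"
proof -
  have "continuous_on UNIV \<Phi>"
    by (intro continuous_at_imp_continuous_on ballI has_derivative_continuous[OF \<Phi>])
  then have "closed M"
    unfolding M by (intro closed_Collect_eq continuous_on_const)
  obtain R where R: "R > 0"
    "\<And>p x. p \<in> K \<Longrightarrow> \<Phi> x = \<Phi> p \<Longrightarrow> x \<noteq> p \<Longrightarrow> norm (x - p) < R \<Longrightarrow> radial_energy J \<alpha> p x > 0"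
    using uniform_radius[OF \<Phi> K(1)] by blast
  have pos: "radial_energy J \<alpha> p x > 0" if "p \<in> K" "x \<in> M" "x \<noteq> p" "norm (x - p) < R" for p x
    using that K(4) by (intro R(2)) (auto simp: M)
  \<comment> \<open>Asking for all positive times lets each jump spend half of the available time,
    so no time is lost along the way.\<close>
  define A where "A = {p \<in> K. \<forall>s>0. charged s p}"
  have step: "q \<in> A" if "q \<in> K" "y \<in> A" "dist q y < R" for q y
  proof -
    have "charged s q" if "s > 0" for s
      by (rule charged_spread[OF \<open>closed M\<close>, of "s / 2" s y q R])
        (use that \<open>q \<in> K\<close> \<open>y \<in> A\<close> \<open>dist q y < R\<close> pos in \<open>auto simp: A_def dist_norm norm_minus_commute\<close>)
    then show ?thesis using that by (simp add: A_def)
  qed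
  \<comment> \<open>The start is charged at time 0 only; a jump from \<open>w0\<close> to itself
    extends this to every positive time.\<close>
  have "w0 \<in> A"
    using charged_spread[OF \<open>closed M\<close> _ _ charged_start, of _ w0 R] K(3) R(1) pos by (auto simp: A_def)
  moreover have "openin (top_of_set K) A"
    unfolding openin_euclidean_subtopology_iff using step R(1) by (auto simp: A_def)
  moreover have "openin (top_of_set K) (K - A)"
    unfolding openin_euclidean_subtopology_iff
  proof (intro conjI ballI)
    fix x assume x: "x \<in> K - A"
    then have "y \<in> K - A" if "y \<in> K" "dist y x < R" for y
      using step[of x y] that by (auto simp: dist_commute)
    then show "\<exists>e>0. \<forall>y\<in>K. dist y x < e \<longrightarrow> y \<in> K - A"
      using R(1) by blast
  qed simp
  then have "closedin (top_of_set K) A"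
    unfolding closedin_def by (auto simp: A_def)
  ultimately have "A = K"
    using K(2) unfolding connected_clopen by blast
  then show ?thesis using assms by (auto simp: A_def)
qed

end

section \<open>Total variance\<close>

context leaf_diffusion
begin

lemma alive_in_ball_measurable:
  assumes "s \<ge> 0"
  shows "{\<omega>\<in>space \<Omega>. ereal s < \<zeta> \<omega> \<and> X s \<omega> \<in> ball p r} \<in> sets \<Omega>"
proof -
  have "{\<omega>\<in>space \<Omega>. ereal s < \<zeta> \<omega>} \<inter> (X s -` ball p r \<inter> space \<Omega>) \<in> sets \<Omega>"
    by (rule sets.Int[OF _ measurable_sets[OF measurable_X[OF assms]]])
      (use pred_alive[OF assms] in \<open>simp_all add: pred_def\<close>)
  also have "{\<omega>\<in>space \<Omega>. ereal s < \<zeta> \<omega>} \<inter> (X s -` ball p r \<inter> space \<Omega>) =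
      {\<omega>\<in>space \<Omega>. ereal s < \<zeta> \<omega> \<and> X s \<omega> \<in> ball p r}" by auto
  finally show ?thesis .
qed

lemma charged_prob_pos:
  assumes "charged s p" "s \<ge> 0" "r > 0"
  shows "emeasure \<Omega> {\<omega>\<in>space \<Omega>. ereal s < \<zeta> \<omega> \<and> X s \<omega> \<in> ball p r} > 0"
proof (rule ccontr)
  let ?A = "{\<omega>\<in>space \<Omega>. ereal s < \<zeta> \<omega> \<and> X s \<omega> \<in> ball p r}"
  note alive_in_ball_measurable[OF \<open>s \<ge> 0\<close>, of p r]
  moreover assume "\<not> emeasure \<Omega> ?A > 0"
  ultimately have "AE \<omega> in \<Omega>. \<not> (ereal s < \<zeta> \<omega> \<and> X s \<omega> \<in> ball p r)"
    by (subst AE_iff_measurable[of ?A]) auto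
  then have "AE \<omega> in \<Omega>. alive (ball_bump 0 p (r\<^sup>2)) s \<omega> = 0"
  proof eventually_elim
    case (elim \<omega>)
    show ?case
    proof (cases "X s \<omega> \<in> ball p r")
      case False
      then have "r\<^sup>2 \<le> norm (X s \<omega> - p) ^ 2"
        using \<open>r > 0\<close> by (intro power_mono) (auto simp: dist_norm norm_minus_commute)
      then show ?thesis by (simp add: alive_def ball_bump_eq_0)
    qed (use elim in \<open>simp add: alive_def\<close>)
  qed
  then have "mean (ball_bump 0 p (r\<^sup>2)) s = 0"
    unfolding mean_def by (rule integral_eq_zero_AE)
  moreover have "mean (ball_bump 0 p (r\<^sup>2)) s > 0"
    using assms by (simp add: charged_def)
  ultimately show False by simp
qed

text \<open>A charged point forces survival up to time \<open>s\<close> with positive probability,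
  so the conditioning in \<open>law_at\<close> is on an event that is not null.\<close>

lemma law_at_charged:
  assumes "s \<ge> 0"
  shows "charged s p \<Longrightarrow> prob_space (law_at \<Omega> X \<zeta> s)"
    and "charged s p \<Longrightarrow> r > 0 \<Longrightarrow> emeasure (law_at \<Omega> X \<zeta> s) (ball p r) > 0"
    and "closed M \<Longrightarrow> AE x in law_at \<Omega> X \<zeta> s. x \<in> M"
proof -
  let ?A = "{\<omega>\<in>space \<Omega>. ereal s < \<zeta> \<omega>}"
  note [measurable] = measurable_X[OF assms] pred_alive[OF assms]
  have A [measurable]: "?A \<in> sets \<Omega>" by measurable
  have X: "X s \<in> borel_measurable (uniform_measure \<Omega> ?A)" by measurable
  show "prob_space (law_at \<Omega> X \<zeta> s)" if "charged s p"
  proof -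
    have "emeasure \<Omega> {\<omega>\<in>space \<Omega>. ereal s < \<zeta> \<omega> \<and> X s \<omega> \<in> ball p 1} \<le> emeasure \<Omega> ?A"
      by (rule emeasure_mono[OF _ A]) auto
    with charged_prob_pos[OF that assms zero_less_one] have "emeasure \<Omega> ?A \<noteq> 0"
      by (metis leD)
    then have "prob_space (uniform_measure \<Omega> ?A)"
      by (intro prob_space_uniform_measure) (simp_all add: emeasure_finite)
    then show ?thesis unfolding law_at_def using X by (rule prob_space.prob_space_distr)
  qed
  show "emeasure (law_at \<Omega> X \<zeta> s) (ball p r) > 0" if "charged s p" "r > 0"
  proof -
    have "?A \<inter> (X s -` ball p r \<inter> space \<Omega>) = {\<omega>\<in>space \<Omega>. ereal s < \<zeta> \<omega> \<and> X s \<omega> \<in> ball p r}"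
      by auto
    then have "emeasure (law_at \<Omega> X \<zeta> s) (ball p r) =
        emeasure \<Omega> {\<omega>\<in>space \<Omega>. ereal s < \<zeta> \<omega> \<and> X s \<omega> \<in> ball p r} / emeasure \<Omega> ?A"
      unfolding law_at_def by (subst emeasure_distr[OF X]) (auto simp: emeasure_uniform_measure)
    also have "\<dots> > 0"
      using charged_prob_pos[OF that(1) assms that(2)]
      by (simp add: ennreal_zero_less_divide emeasure_finite less_top[symmetric])
    finally show ?thesis .
  qed
  show "AE x in law_at \<Omega> X \<zeta> s. x \<in> M" if "closed M"
  proof -
    have "AE \<omega> in uniform_measure \<Omega> ?A. X s \<omega> \<in> M"
      by (rule AE_uniform_measureI[OF A]) (use path(3) assms in auto)
    then show ?thesis
      unfolding law_at_def using that by (subst AE_distr_iff[OF X]) auto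
  qed
qed

end

section \<open>Vanishing and positivity of the total variance\<close>

lemma total_variance_eq_0:
  assumes "sigma_finite_measure \<mu>" and borel: "sets \<mu> = sets borel" and g: "g \<in> borel_measurable borel"
    and const: "AE x in \<mu>. g x = (c :: 'b::euclidean_space)"
  shows "total_variance \<mu> g = 0"
proof -
  interpret sigma_finite_measure \<mu> by fact
  have [measurable]: "g \<in> borel_measurable \<mu>" using g borel by (simp cong: measurable_cong_sets)
  have "(\<integral>\<^sup>+ p. ennreal ((norm (g (fst p) - g (snd p)))\<^sup>2) \<partial>(\<mu> \<Otimes>\<^sub>M \<mu>)) =
      (\<integral>\<^sup>+ x. \<integral>\<^sup>+ y. ennreal ((norm (g x - g y))\<^sup>2) \<partial>\<mu> \<partial>\<mu>)"
    by (subst nn_integral_fst[symmetric]) auto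
  also have "\<dots> = (\<integral>\<^sup>+ x. 0 \<partial>\<mu>)"
  proof (rule nn_integral_cong_AE)
    show "AE x in \<mu>. (\<integral>\<^sup>+ y. ennreal ((norm (g x - g y))\<^sup>2) \<partial>\<mu>) = 0"
      using const
    proof eventually_elim
      case (elim x)
      have "(\<integral>\<^sup>+ y. ennreal ((norm (g x - g y))\<^sup>2) \<partial>\<mu>) = (\<integral>\<^sup>+ y. 0 \<partial>\<mu>)"
      proof (rule nn_integral_cong_AE)
        show "AE y in \<mu>. ennreal ((norm (g x - g y))\<^sup>2) = 0"
          using const by eventually_elim (simp add: elim)
      qed
      then show ?case by simp
    qed
  qed
  finally show ?thesis by (simp add: total_variance_def)
qed

text \<open>Two independent copies fall near \<open>p\<close> and near \<open>q\<close> with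
  positive probability, and there the values of \<open>g\<close> differ by at least a third of
  \<open>dist (g p) (g q)\<close>.\<close>

lemma total_variance_pos:
  assumes "sigma_finite_measure \<mu>" and borel: "sets \<mu> = sets borel" and g: "continuous_on UNIV g"
    and pos: "\<And>r. r > 0 \<Longrightarrow> emeasure \<mu> (ball p r) > 0" "\<And>r. r > 0 \<Longrightarrow> emeasure \<mu> (ball q r) > 0"
    and ne: "g p \<noteq> g q"
  shows "total_variance \<mu> g > 0"
proof -
  interpret sigma_finite_measure \<mu> by fact
  define \<eta> where "\<eta> = dist (g p) (g q) / 3"
  have \<eta>: "\<eta> > 0" using ne by (simp add: \<eta>_def)
  have "\<exists>r>0. \<forall>x\<in>ball y r. dist (g x) (g y) < \<eta>" for y
    using g \<eta> unfolding continuous_on_iff by (metis UNIV_I dist_commute mem_ball)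
  then obtain r1 r2 where r: "r1 > 0" "\<And>x. x \<in> ball p r1 \<Longrightarrow> dist (g x) (g p) < \<eta>"
    "r2 > 0" "\<And>x. x \<in> ball q r2 \<Longrightarrow> dist (g x) (g q) < \<eta>" by metis
  have [measurable]: "ball p r1 \<in> sets \<mu>" "ball q r2 \<in> sets \<mu>" using borel by auto
  have far: "\<eta> \<le> norm (g x - g y)" if "x \<in> ball p r1" "y \<in> ball q r2" for x y
  proof -
    have "dist (g p) (g q) \<le> dist (g x) (g p) + dist (g x) (g y) + dist (g y) (g q)"
      using dist_triangle[of "g p" "g q" "g x"] dist_triangle[of "g x" "g q" "g y"]
      by (simp add: dist_commute)
    then show ?thesis using r(2)[OF that(1)] r(4)[OF that(2)] by (simp add: \<eta>_def dist_norm)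
  qed
  have "0 < ennreal (\<eta>\<^sup>2) * (emeasure \<mu> (ball p r1) * emeasure \<mu> (ball q r2))"
    using \<eta> pos(1)[OF r(1)] pos(2)[OF r(3)] by (simp add: ennreal_zero_less_mult_iff)
  also have "\<dots> = (\<integral>\<^sup>+ z. ennreal (\<eta>\<^sup>2) * indicator (ball p r1 \<times> ball q r2) z \<partial>(\<mu> \<Otimes>\<^sub>M \<mu>))"
    by (subst nn_integral_cmult_indicator) (auto simp: emeasure_pair_measure_Times)
  also have "\<dots> \<le> (\<integral>\<^sup>+ z. ennreal ((norm (g (fst z) - g (snd z)))\<^sup>2) \<partial>(\<mu> \<Otimes>\<^sub>M \<mu>))"
    using far \<eta> by (intro nn_integral_mono) (auto simp: indicator_def intro!: ennreal_leI power_mono)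
  finally show ?thesis
    by (simp add: total_variance_def ennreal_zero_less_divide)
qed

theorem theorem5p1:
  fixes f :: "real^'d \<Rightarrow> real^'i \<Rightarrow> real^'o"
    and xs :: "'n::finite \<Rightarrow> real^'i"
    and \<alpha> t :: real
    and what :: "real^'d"
    and \<Omega> :: "'p measure" and F :: "real \<Rightarrow> 'p measure"
    and X :: "real \<Rightarrow> 'p \<Rightarrow> real^'d" and \<zeta> :: "'p \<Rightarrow> ereal"
  assumes "\<And>x. smooth_map (\<lambda>w. f w x)"
    and "\<And>w. rank (stacked_jacobian f xs w) = CARD('n) * CARD('o)"
    and "\<alpha> > 0" and "t > 0"
    and "riemannian_brownian_motion (reparam f (range xs) what) (kernel_tangent f xs) \<alpha> what
           \<Omega> F X \<zeta>"
  shows "(\<forall>x\<in>range xs. total_variance (law_at \<Omega> X \<zeta> t) (\<lambda>w. f w x) = 0) \<and>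
         (\<forall>xt. xt \<notin> range xs \<longrightarrow>
            (\<exists>w'. w' \<in> path_reparam f (range xs) what \<and>
                  w' \<notin> path_reparam f (range xs \<union> {xt}) what) \<longrightarrow>
            total_variance (law_at \<Omega> X \<zeta> t) (\<lambda>w. f w xt) > 0)"
proof -
  define J where "J = stacked_jacobian f xs"
  define M where "M = reparam f (range xs) what"
  have smooth: "smooth_map (stacked f xs)"
    unfolding stacked_def[abs_def] by (intro smooth_map_vec_lambda smooth_map_vec_nth assms(1))
  have der: "(stacked f xs has_derivative (*v) (J w)) (at w)" for w
    using smooth_map_differentiable[OF smooth] jacobian_works unfolding J_def by blast
  have kernel: "kernel_tangent f xs = (\<lambda>w. {v. J w *v v = 0})"
    by (simp add: kernel_tangent_def J_def fun_eq_iff)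
  interpret leaf_diffusion J \<alpha> M what \<Omega> F X \<zeta>
  proof
    show "smooth_map (\<lambda>w. J w $ i $ j)" for i j
      unfolding J_def by (rule smooth_map_jacobian_entry[OF smooth])
    show "rank (J w) = CARD('n \<times> 'o)" for w
      using assms(2) by (simp add: J_def)
    show "riemannian_brownian_motion M (\<lambda>w. {v. J w *v v = 0}) \<alpha> what \<Omega> F X \<zeta>"
      using assms(5) unfolding kernel M_def .
  qed (rule \<open>\<alpha> > 0\<close>)
  have M: "M = {w. stacked f xs w = stacked f xs what}"
    by (auto simp: M_def reparam_def stacked_def vec_eq_iff)
  have "t \<ge> 0" using \<open>t > 0\<close> by simp
  have cont: "continuous_on UNIV (\<lambda>w. f w x)" for x
    by (rule smooth_map_continuous_on[OF assms(1)])
  have "closed M"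
    unfolding M by (intro closed_Collect_eq smooth_map_continuous_on smooth continuous_on_const)
  have "what \<in> M" by (simp add: M)
  \<comment> \<open>The one-point set is compact and connected. This step also yields positive
    survival probability, hence a genuine probability law at time \<open>t\<close>.\<close>
  then have charged_what: "charged t what"
    by (intro charged_connected[OF der M, of "{what}"]) (use \<open>t > 0\<close> in auto)
  interpret L: prob_space "law_at \<Omega> X \<zeta> t"
    by (rule law_at_charged(1)[OF \<open>t \<ge> 0\<close> charged_what])
  have sets: "sets (law_at \<Omega> X \<zeta> t) = sets borel" by (simp add: law_at_def)
  show ?thesis
  proof (intro conjI ballI allI impI)
    fix x assume "x \<in> range xs"
    have "AE w in law_at \<Omega> X \<zeta> t. f w x = f what x"
      using law_at_charged(3)[OF \<open>t \<ge> 0\<close> \<open>closed M\<close>]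
      by eventually_elim (use \<open>x \<in> range xs\<close> in \<open>auto simp: M_def reparam_def\<close>)
    then show "total_variance (law_at \<Omega> X \<zeta> t) (\<lambda>w. f w x) = 0"
      by (intro total_variance_eq_0 L.sigma_finite_measure_axioms sets
          borel_measurable_continuous_onI cont)
  next
    fix xt assume "\<exists>w'. w' \<in> path_reparam f (range xs) what \<and>
      w' \<notin> path_reparam f (range xs \<union> {xt}) what"
    \<comment> \<open>The path that witnesses the first membership has the right endpoints, so it
      cannot keep \<open>f\<close> at \<open>xt\<close> constant; otherwise it would witness the
      excluded membership too.\<close>
    then obtain \<gamma> :: "real \<Rightarrow> real^'d" where \<gamma>: "\<gamma> piecewise_differentiable_on {0..1}" "\<gamma> 0 = what"
      "\<And>r. r \<in> {0..1} \<Longrightarrow> \<gamma> r \<in> M" "\<not> (\<forall>r\<in>{0..1}. \<gamma> r \<in> reparam f (range xs \<union> {xt}) what)"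
      unfolding path_reparam_def M_def by blast
    from \<gamma>(3,4) obtain r where r: "r \<in> {0..1}" "f (\<gamma> r) xt \<noteq> f what xt"
      unfolding M_def reparam_def by blast
    have "continuous_on {0..1} \<gamma>" using \<gamma>(1) by (simp add: piecewise_differentiable_on_def)
    then have "compact (\<gamma> ` {0..1})" "connected (\<gamma> ` {0..1})"
      by (auto intro: compact_continuous_image connected_continuous_image)
    moreover have "what \<in> \<gamma> ` {0..1}" using \<gamma>(2) by (metis atLeastAtMost_iff image_eqI order_refl zero_le_one)
    \<comment> \<open>The image of the path serves as the compact connected set joining the start to
      a point where \<open>f\<close> at \<open>xt\<close> takes another value.\<close>
    ultimately have "charged t (\<gamma> r)"
      by (rule charged_connected[OF der M]) (use \<gamma>(3) r \<open>t > 0\<close> in auto)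
    then show "total_variance (law_at \<Omega> X \<zeta> t) (\<lambda>w. f w xt) > 0"
      using r(2)
      by (intro total_variance_pos[where p = "\<gamma> r" and q = what] L.sigma_finite_measure_axioms sets cont
          law_at_charged(2)[OF \<open>t \<ge> 0\<close>] charged_what)
  qed
qed

end
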